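(* Let $m,n\ge1$, $N=m+n$, and let $k\ge0$ be an integer. For every $f\in\mathcal{D}(\mathbb{R}^{m+n})$ the following identity holds (in the sense of distributions on $\mathbb{R}^m\times\mathbb{R}^n$): $$f(x,y)=\sum_{|\beta|+|\gamma|\le k}\frac{(-1)^{|\beta|+|\gamma|}}{\beta!\,\gamma!}\Big(\int_{\mathbb{R}^N}f(x,y)x^\beta y^\gamma\,dx\,dy\Big)D_x^\beta D_y^\gamma\delta_0+\sum_{|\gamma|\le k}\ \sum_{|\beta|=k+1-|\gamma|}\frac{(-1)^{|\gamma|}}{\gamma!}D_x^\beta[\mathcal{R}f]_{\beta\gamma}(x)\,D_y^\gamma\delta_0(y)+\sum_{|\gamma|=k+1}D_y^\gamma F_\gamma(x,y),$$ where, for $|\gamma|\le k$ and $|\beta|+|\gamma|=k+1$, $$[\mathcal{R}f]_{\beta\gamma}(x)=\frac{(-1)^{|\beta|}|\beta|}{\beta!}\int_0^1(1-t)^{|\beta|-1}\Big(\frac xt\Big)^{\beta}\int_{\mathbb{R}^n}f\Big(\frac xt,y\Big)y^\gamma\,dy\,\frac{dt}{t^m},$$ and, for $|\gamma|=k+1$, $$F_\gamma(x,y)=(k+1)\frac{(-1)^{k+1}}{\gamma!}\int_0^1(1-t)^k\Big(\frac yt\Big)^{\gamma}f\Big(x,\frac yt\Big)\frac{dt}{t^n}.$$ Moreover, for $1\le p<\frac{n}{n-1}$ and $|\gamma|=k+1$, $$\|F_\gamma\|_{L^p(\mathbb{R}^N)}\le\||y|^{k+1}f\|_{L^p(\mathbb{R}^N)},$$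 and, for $1\le p<\frac{m}{m-1}$, $|\gamma|\le k$ and $|\beta|+|\gamma|=k+1$, $$\|[\mathcal{R}f]_{\beta\gamma}\|_{L^p(\mathbb{R}^m)}\le\|f\|_{L^p(\mathbb{R}^m,|x|^{|\beta|};\,L^1(\mathbb{R}^n,|y|^{|\gamma|}))}.$$
   Context: $\mathcal{D}(\mathbb{R}^N)$ is the space of $C^\infty$ compactly supported functions. Points of $\mathbb{R}^N$ are $(x,y)\in\mathbb{R}^m\times\mathbb{R}^n$; $\beta\in\mathbb{Z}_{\ge0}^m$ and $\gamma\in\mathbb{Z}_{\ge0}^n$ are multi-indices. $\delta_0$ is the Dirac mass at the origin of $\mathbb{R}^N$, $\delta_0(y)$ the Dirac mass at the origin of $\mathbb{R}^n$, and $D_x^\beta g(x)\,D_y^\gamma\delta_0(y)$ is the tensor product of distributions. The mixed norm is $$\|f\|^p_{L^p(\mathbb{R}^m,|x|^{|\beta|};\,L^1(\mathbb{R}^n,|y|^{|\gamma|}))}=\int_{\mathbb{R}^m}|x|^{p|\beta|}\Big(\int_{\mathbb{R}^n}|y|^{|\gamma|}|f(x,y)|\,dy\Big)^p dx.$$ The convention $\frac10=\infty$ is used for the exponents.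
   Formalization: The norm bounds with constant 1 fail for p>1 (m=n=1, k=0, p=2: Hardy); the right sides carry the factor (j/α!)B(j,1−d+d/p), (d,j,α)=(n,k+1,γ) or (m,|β|,β), which is 1/α!≤1 at p=1 and not always optimal for mixed α. Functions are real-valued. *)

theory Defs
  imports "HOL-Analysis.Analysis"
begin

section \<open>Test functions\<close>

definition dir_deriv :: "'a::real_normed_vector \<Rightarrow> ('a \<Rightarrow> real) \<Rightarrow> 'a \<Rightarrow> real" where
  "dir_deriv v \<phi> = (\<lambda>x. frechet_derivative \<phi> (at x) v)"

fun C_diff :: "nat \<Rightarrow> ('a::euclidean_space \<Rightarrow> real) \<Rightarrow> bool" where
  "C_diff 0 \<phi> \<longleftrightarrow> continuous_on UNIV \<phi>"
| "C_diff (Suc r) \<phi> \<longleftrightarrow> \<phi> differentiable_on UNIV \<and> (\<forall>b\<in>Basis. C_diff r (dir_deriv b \<phi>))"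

definition test_functions :: "('a::euclidean_space \<Rightarrow> real) set" where
  "test_functions = {\<phi>. (\<forall>r. C_diff r \<phi>) \<and> compact (closure {x. \<phi> x \<noteq> 0})}"


section \<open>Multi-indices\<close>

text \<open>A multi-index of length \<open>CARD('i)\<close> is a function \<open>'i \<Rightarrow> nat\<close>.\<close>

definition mdeg :: "('i::finite \<Rightarrow> nat) \<Rightarrow> nat" where
  "mdeg \<alpha> = (\<Sum>i\<in>UNIV. \<alpha> i)"

definition mfact :: "('i::finite \<Rightarrow> nat) \<Rightarrow> real" where
  "mfact \<alpha> = (\<Prod>i\<in>UNIV. fact (\<alpha> i))"

definition mpow :: "real ^ 'i::finite \<Rightarrow> ('i \<Rightarrow> nat) \<Rightarrow> real" where
  "mpow x \<alpha> = (\<Prod>i\<in>UNIV. (x $ i) ^ \<alpha> i)"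

text \<open>
  \<open>mderiv e \<alpha>\<close> applies, for each index \<open>i\<close>, the derivative in direction \<open>e i\<close> exactly \<open>\<alpha> i\<close> times.
  The indices are run through in some arbitrary fixed order, which is immaterial on smooth functions.
  The frame \<open>e\<close> selects the variables: \<open>frame\<close> gives the partial derivatives on \<open>real ^ 'i\<close>,
  \<open>frame_x\<close> and \<open>frame_y\<close> those in the first and second variable on \<open>real ^ 'm \<times> real ^ 'n\<close>.
\<close>

definition mderiv ::
  "('i::finite \<Rightarrow> 'a::real_normed_vector) \<Rightarrow> ('i \<Rightarrow> nat) \<Rightarrow> ('a \<Rightarrow> real) \<Rightarrow> 'a \<Rightarrow> real" where
  "mderiv e \<alpha> \<phi> =
     foldr (\<lambda>i. dir_deriv (e i) ^^ \<alpha> i) (SOME is. distinct is \<and> set is = UNIV) \<phi>"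

definition frame :: "'i::finite \<Rightarrow> real ^ 'i" where
  "frame i = axis i 1"

definition frame_x :: "'m::finite \<Rightarrow> (real ^ 'm) \<times> (real ^ 'n::finite)" where
  "frame_x i = (axis i 1, 0)"

definition frame_y :: "'n::finite \<Rightarrow> (real ^ 'm::finite) \<times> (real ^ 'n)" where
  "frame_y j = (0, axis j 1)"


section \<open>Distributions\<close>

text \<open>
  Distributions are represented by their action on test functions; two of them are equal iff
  they agree on \<open>test_functions\<close>.
\<close>

type_synonym 'a distr = "('a \<Rightarrow> real) \<Rightarrow> real"

definition distr_of :: "('a::euclidean_space \<Rightarrow> real) \<Rightarrow> 'a distr" where
  "distr_of g = (\<lambda>\<phi>. \<integral>x. g x * \<phi> x \<partial>lborel)"

definition dirac0 :: "'a::euclidean_space distr" where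
  "dirac0 = (\<lambda>\<phi>. \<phi> 0)"

definition distr_deriv ::
  "('i::finite \<Rightarrow> 'a::euclidean_space) \<Rightarrow> ('i \<Rightarrow> nat) \<Rightarrow> 'a distr \<Rightarrow> 'a distr" where
  "distr_deriv e \<alpha> T = (\<lambda>\<phi>. (-1) ^ mdeg \<alpha> * T (mderiv e \<alpha> \<phi>))"

definition distr_tensor ::
  "'a::euclidean_space distr \<Rightarrow> 'b::euclidean_space distr \<Rightarrow> ('a \<times> 'b) distr" where
  "distr_tensor S T = (\<lambda>\<phi>. S (\<lambda>x. T (\<lambda>y. \<phi> (x, y))))"


section \<open>Norms\<close>

definition Lp_space :: "real \<Rightarrow> ('a::euclidean_space \<Rightarrow> real) set" where
  "Lp_space p = {g \<in> borel_measurable lborel. integrable lborel (\<lambda>x. \<bar>g x\<bar> powr p)}"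

definition Lp_norm :: "real \<Rightarrow> ('a::euclidean_space \<Rightarrow> real) \<Rightarrow> real" where
  "Lp_norm p g = (\<integral>x. \<bar>g x\<bar> powr p \<partial>lborel) powr (1 / p)"

text \<open>The norm of \<open>L\<^sup>p(\<real>\<^sup>m, |x|\<^sup>a; L\<^sup>1(\<real>\<^sup>n, |y|\<^sup>b))\<close>.\<close>

definition mixed_norm ::
  "real \<Rightarrow> nat \<Rightarrow> nat \<Rightarrow> ((real ^ 'm::finite) \<times> (real ^ 'n::finite) \<Rightarrow> real) \<Rightarrow> real" where
  "mixed_norm p a b f =
     (\<integral>x. norm x powr (p * real a) * (\<integral>y. norm y ^ b * \<bar>f (x, y)\<bar> \<partial>lborel) powr p \<partial>lborel)
       powr (1 / p)"


section \<open>The remainder terms\<close>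

definition R_op ::
  "((real ^ 'm::finite) \<times> (real ^ 'n::finite) \<Rightarrow> real) \<Rightarrow> ('m \<Rightarrow> nat) \<Rightarrow> ('n \<Rightarrow> nat) \<Rightarrow>
   real ^ 'm \<Rightarrow> real" where
  "R_op f \<beta> \<gamma> x =
     (-1) ^ mdeg \<beta> * real (mdeg \<beta>) / mfact \<beta> *
     (LINT t:{0<..<1}|lborel.
        (1 - t) ^ (mdeg \<beta> - 1) * mpow (x /\<^sub>R t) \<beta> *
        (\<integral>y. f (x /\<^sub>R t, y) * mpow y \<gamma> \<partial>lborel) / t ^ CARD('m))"

definition F_rem ::
  "((real ^ 'm::finite) \<times> (real ^ 'n::finite) \<Rightarrow> real) \<Rightarrow> nat \<Rightarrow> ('n \<Rightarrow> nat) \<Rightarrow>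
   (real ^ 'm) \<times> (real ^ 'n) \<Rightarrow> real" where
  "F_rem f k \<gamma> = (\<lambda>(x, y).
     (real k + 1) * (-1) ^ (k + 1) / mfact \<gamma> *
     (LINT t:{0<..<1}|lborel.
        (1 - t) ^ k * mpow (y /\<^sub>R t) \<gamma> * f (x, y /\<^sub>R t) / t ^ CARD('n)))"

text \<open>
  The constant in the norm estimates, for a remainder of order \<open>j\<close> in \<open>d\<close> variables
  with multi-index \<open>\<alpha>\<close>, \<open>|\<alpha>| = j\<close>. It is
  \[ \frac{j}{\alpha!} \int_0^1 (1-t)^{j-1}\, t^{d/p-d}\, dt, \]
  which is what Minkowski's integral inequality gives; it is finite iff \<open>p < d / (d - 1)\<close>, and for
  \<open>p = 1\<close> it equals \<open>1 / \<alpha>! \<le> 1\<close>. For \<open>p > 1\<close> the estimates are in general false with constant 1: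
  for \<open>d = j = 1\<close> they are Hardy's inequality
  \<open>\<parallel>\<integral>\<^sub>y\<^sup>\<infinity> g(s) ds\<parallel>\<^sub>p \<le> p \<parallel>y g\<parallel>\<^sub>p\<close> on the half-line, where \<open>p\<close> is optimal.
\<close>

definition remainder_const :: "real \<Rightarrow> nat \<Rightarrow> ('i::finite \<Rightarrow> nat) \<Rightarrow> real" where
  "remainder_const p j \<alpha> =
     real j / mfact \<alpha> * Beta (real j) (1 - real CARD('i) + real CARD('i) / p)"

end

(* Taylor's formula with integral remainder is applied to the test function, first in y at (x, 0)
   to order k, then to each coefficient of the y-expansion in x at 0 to order k - |gamma|.
   Integrating against f and substituting z -> z/t in the remainders moves the dilation from the
   test function to f, which produces F_gamma and R f. Both remainders are instances of one
   averaging operator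
     u -> (z -> integral_0^1 (1 - t)^j u(S_{1/t} z) t^{-d} dt)
   for a one-parameter group S of dilations with Jacobian t^d, so the two norm estimates and the
   two duality identities are proved once. *)

theory Submission
  imports Defs
begin

section \<open>Taylor expansion along a frame\<close>

text \<open>Substituting s = |y| / t shows that \<open>F_rem\<close> is in general of size |y|^(1-n)
  near y = 0, which is p-integrable there exactly for p < n / (n - 1); \<open>R_op\<close> behaves
  likewise with m. Hence the remainders are not estimated pointwise. Duality rests on Fubini in (t,
  z), with the z-integral inside so that the Jacobian t^d cancels t^(-d). The norms rest on Jensen's
  inequality, where the same threshold for p reappears as positivity of the second argument of
  \<open>Beta\<close>. Expanding in y first gives the sum its shape: the Taylor coefficients at (x,
  0) depend on x alone, so f enters through its moments in y, and the order of the expansion in x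
  can be chosen for each \<gamma> so that all remainders have total order k + 1. The derivatives in
  \<open>mderiv\<close> run through the indices in an order fixed only by choice, so even Taylor's
  formula presupposes that mixed derivatives commute. This is obtained from symmetric second
  differences.\<close>

definition smooth :: "('a::euclidean_space \<Rightarrow> real) \<Rightarrow> bool" where
  "smooth \<phi> \<longleftrightarrow> (\<forall>r. C_diff r \<phi>)"

lemma smooth_differentiable: "smooth \<phi> \<Longrightarrow> \<phi> differentiable (at x)"
  unfolding smooth_def by (metis C_diff.simps(2) differentiable_on_eq_differentiable_at UNIV_I open_UNIV)

lemma smooth_continuous: "smooth \<phi> \<Longrightarrow> continuous_on S \<phi>"
  unfolding smooth_def by (metis C_diff.simps(1) continuous_on_subset subset_UNIV)

lemma smooth_dir_deriv: "smooth \<phi> \<Longrightarrow> b \<in> Basis \<Longrightarrow> smooth (dir_deriv b \<phi>)"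
  unfolding smooth_def by (metis C_diff.simps(2))

lemma has_derivative_frechet: "smooth \<phi> \<Longrightarrow> (\<phi> has_derivative frechet_derivative \<phi> (at x)) (at x)"
  using smooth_differentiable frechet_derivative_works by blast

section \<open>Symmetry of mixed second derivatives\<close>

lemma dir_deriv_along_line:
  assumes "\<phi> differentiable (at (a + t *\<^sub>R v))"
  shows "((\<lambda>t. \<phi> (a + t *\<^sub>R v)) has_real_derivative dir_deriv v \<phi> (a + t *\<^sub>R v)) (at t)"
proof -
  let ?D = "frechet_derivative \<phi> (at (a + t *\<^sub>R v))"
  have D: "(\<phi> has_derivative ?D) (at (a + t *\<^sub>R v))"
    using assms frechet_derivative_works by blast
  have "((\<lambda>t. \<phi> (a + t *\<^sub>R v)) has_derivative (\<lambda>s. ?D (s *\<^sub>R v))) (at t)"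
    by (rule has_derivative_compose[of "\<lambda>t. a + t *\<^sub>R v" _ t UNIV \<phi>, OF _ D])
       (auto intro!: derivative_eq_intros)
  moreover have "?D (s *\<^sub>R v) = dir_deriv v \<phi> (a + t *\<^sub>R v) * s" for s
    using linear_scale[OF has_derivative_linear[OF D]] by (simp add: dir_deriv_def)
  ultimately show ?thesis
    by (simp add: has_field_derivative_def)
qed

text \<open>The mean value theorem is applied twice: in direction b to the increment along c, then
  in direction c to the derivative along b. The second difference is symmetric in b and c although
  the order of the derivatives on the right is not, and this is what makes derivatives
  commute.\<close>

lemma second_difference_mvt:
  fixes g :: "'a::real_normed_vector \<Rightarrow> real"
  assumes g: "\<And>x. g differentiable (at x)" and gb: "\<And>x. dir_deriv b g differentiable (at x)"
    and h: "h > 0"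
  obtains \<xi> \<eta> where "0 < \<xi>" "\<xi> < h" "0 < \<eta>" "\<eta> < h"
    "g (x + h *\<^sub>R b + h *\<^sub>R c) - g (x + h *\<^sub>R b) - g (x + h *\<^sub>R c) + g x
       = h * h * dir_deriv c (dir_deriv b g) (x + \<xi> *\<^sub>R b + \<eta> *\<^sub>R c)"
proof -
  define u where "u s = g ((x + h *\<^sub>R c) + s *\<^sub>R b) - g (x + s *\<^sub>R b)" for s
  have "(u has_real_derivative
      dir_deriv b g ((x + h *\<^sub>R c) + s *\<^sub>R b) - dir_deriv b g (x + s *\<^sub>R b)) (at s)" for s
    unfolding u_def by (intro DERIV_diff dir_deriv_along_line g)
  from MVT2[OF h this] obtain \<xi> where \<xi>: "0 < \<xi>" "\<xi> < h" and
    u: "u h - u 0 = (h - 0) * (dir_deriv b g ((x + h *\<^sub>R c) + \<xi> *\<^sub>R b) - dir_deriv b g (x + \<xi> *\<^sub>R b))"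
    by metis
  have "((\<lambda>s. dir_deriv b g ((x + \<xi> *\<^sub>R b) + s *\<^sub>R c)) has_real_derivative
      dir_deriv c (dir_deriv b g) ((x + \<xi> *\<^sub>R b) + s *\<^sub>R c)) (at s)" for s
    by (intro dir_deriv_along_line gb)
  from MVT2[OF h this] obtain \<eta> where \<eta>: "0 < \<eta>" "\<eta> < h" and
    v: "dir_deriv b g ((x + \<xi> *\<^sub>R b) + h *\<^sub>R c) - dir_deriv b g ((x + \<xi> *\<^sub>R b) + 0 *\<^sub>R c)
         = (h - 0) * dir_deriv c (dir_deriv b g) ((x + \<xi> *\<^sub>R b) + \<eta> *\<^sub>R c)"
    by metis
  have "g (x + h *\<^sub>R b + h *\<^sub>R c) - g (x + h *\<^sub>R b) - g (x + h *\<^sub>R c) + g x = u h - u 0"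
    by (simp add: u_def algebra_simps)
  also have "\<dots> = h * h * dir_deriv c (dir_deriv b g) (x + \<xi> *\<^sub>R b + \<eta> *\<^sub>R c)"
    using u v by (simp add: algebra_simps)
  finally show ?thesis using that \<xi> \<eta> by blast
qed

text \<open>The intermediate points have both parameters in (0, 1/(n+1)), so they collapse to x, and
  continuity of the mixed derivative gives the limit.\<close>

lemma mixed_difference_quotient_tendsto:
  fixes g :: "'a::real_normed_vector \<Rightarrow> real"
  assumes g: "\<And>x. g differentiable (at x)" and gb: "\<And>x. dir_deriv b g differentiable (at x)"
    and cont: "continuous_on UNIV (dir_deriv c (dir_deriv b g))"
  shows "(\<lambda>n. (g (x + inverse (Suc n) *\<^sub>R b + inverse (Suc n) *\<^sub>R c) - g (x + inverse (Suc n) *\<^sub>R b)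
      - g (x + inverse (Suc n) *\<^sub>R c) + g x) / (inverse (Suc n) * inverse (Suc n)))
    \<longlonglongrightarrow> dir_deriv c (dir_deriv b g) x"
proof -
  have "\<forall>n. \<exists>\<xi> \<eta>. 0 < \<xi> \<and> \<xi> < inverse (real (Suc n)) \<and> 0 < \<eta> \<and> \<eta> < inverse (real (Suc n)) \<and>
      g (x + inverse (Suc n) *\<^sub>R b + inverse (Suc n) *\<^sub>R c) - g (x + inverse (Suc n) *\<^sub>R b)
      - g (x + inverse (Suc n) *\<^sub>R c) + g x
      = inverse (Suc n) * inverse (Suc n) * dir_deriv c (dir_deriv b g) (x + \<xi> *\<^sub>R b + \<eta> *\<^sub>R c)"
  proof
    fix n
    have "0 < inverse (real (Suc n))" by simp
    from second_difference_mvt[OF g gb this, where x=x and c=c] show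
      "\<exists>\<xi> \<eta>. 0 < \<xi> \<and> \<xi> < inverse (real (Suc n)) \<and> 0 < \<eta> \<and> \<eta> < inverse (real (Suc n)) \<and>
      g (x + inverse (Suc n) *\<^sub>R b + inverse (Suc n) *\<^sub>R c) - g (x + inverse (Suc n) *\<^sub>R b)
      - g (x + inverse (Suc n) *\<^sub>R c) + g x
      = inverse (Suc n) * inverse (Suc n) * dir_deriv c (dir_deriv b g) (x + \<xi> *\<^sub>R b + \<eta> *\<^sub>R c)"
      by metis
  qed
  then obtain \<xi> \<eta> where \<xi>: "\<And>n. 0 < \<xi> n" "\<And>n. \<xi> n < inverse (real (Suc n))"
    and \<eta>: "\<And>n. 0 < \<eta> n" "\<And>n. \<eta> n < inverse (real (Suc n))"
    and eq: "\<And>n. g (x + inverse (Suc n) *\<^sub>R b + inverse (Suc n) *\<^sub>R c) - g (x + inverse (Suc n) *\<^sub>R b)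
      - g (x + inverse (Suc n) *\<^sub>R c) + g x
      = inverse (Suc n) * inverse (Suc n) * dir_deriv c (dir_deriv b g) (x + \<xi> n *\<^sub>R b + \<eta> n *\<^sub>R c)"
    by metis
  have lim: "\<xi> \<longlonglongrightarrow> 0" "\<eta> \<longlonglongrightarrow> 0"
    by (rule tendsto_sandwich[OF _ _ tendsto_const LIMSEQ_inverse_real_of_nat];
        intro always_eventually allI less_imp_le \<xi> \<eta>)+
  have "(\<lambda>n. x + \<xi> n *\<^sub>R b + \<eta> n *\<^sub>R c) \<longlonglongrightarrow> x + 0 *\<^sub>R b + 0 *\<^sub>R c"
    by (intro tendsto_intros lim)
  then have "(\<lambda>n. dir_deriv c (dir_deriv b g) (x + \<xi> n *\<^sub>R b + \<eta> n *\<^sub>R c)) \<longlonglongrightarrow> dir_deriv c (dir_deriv b g) x"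
    using cont by (intro isCont_tendsto_compose[of x "dir_deriv c (dir_deriv b g)", rotated])
      (auto simp: continuous_on_eq_continuous_at)
  then show ?thesis
    unfolding eq by (simp del: of_nat_Suc)
qed

text \<open>Exchanging b and c leaves the second difference quotient unchanged, so both mixed
  derivatives are limits of one sequence.\<close>

lemma dir_deriv_commute:
  assumes "smooth \<phi>" "b \<in> Basis" "c \<in> Basis"
  shows "dir_deriv b (dir_deriv c \<phi>) = dir_deriv c (dir_deriv b \<phi>)"
proof
  fix x
  note s = smooth_differentiable smooth_dir_deriv smooth_continuous assms
  have "(\<lambda>n. (\<phi> (x + inverse (Suc n) *\<^sub>R b + inverse (Suc n) *\<^sub>R c) - \<phi> (x + inverse (Suc n) *\<^sub>R b)
      - \<phi> (x + inverse (Suc n) *\<^sub>R c) + \<phi> x) / (inverse (Suc n) * inverse (Suc n)))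
    \<longlonglongrightarrow> dir_deriv c (dir_deriv b \<phi>) x"
    by (intro mixed_difference_quotient_tendsto s)
  moreover have "(\<lambda>n. (\<phi> (x + inverse (Suc n) *\<^sub>R c + inverse (Suc n) *\<^sub>R b) - \<phi> (x + inverse (Suc n) *\<^sub>R c)
      - \<phi> (x + inverse (Suc n) *\<^sub>R b) + \<phi> x) / (inverse (Suc n) * inverse (Suc n)))
    \<longlonglongrightarrow> dir_deriv b (dir_deriv c \<phi>) x"
    by (intro mixed_difference_quotient_tendsto s)
  ultimately show "dir_deriv b (dir_deriv c \<phi>) x = dir_deriv c (dir_deriv b \<phi>) x"
    by (intro LIMSEQ_unique) (simp_all add: algebra_simps)
qed

section \<open>Iterated derivatives along a frame\<close>

lemma smooth_funpow: "smooth \<phi> \<Longrightarrow> b \<in> Basis \<Longrightarrow> smooth ((dir_deriv b ^^ n) \<phi>)"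
  by (induction n) (auto intro: smooth_dir_deriv)

lemma smooth_foldr:
  "smooth \<phi> \<Longrightarrow> (\<And>i. e i \<in> Basis) \<Longrightarrow> smooth (foldr (\<lambda>i. dir_deriv (e i) ^^ \<alpha> i) js \<phi>)"
  by (induction js) (auto intro: smooth_funpow)

lemma smooth_mderiv: "smooth \<phi> \<Longrightarrow> (\<And>i. e i \<in> Basis) \<Longrightarrow> smooth (mderiv e \<alpha> \<phi>)"
  unfolding mderiv_def by (rule smooth_foldr)

lemma dir_deriv_commute_funpow:
  assumes "smooth \<phi>" "b \<in> Basis" "c \<in> Basis"
  shows "dir_deriv b ((dir_deriv c ^^ n) \<phi>) = (dir_deriv c ^^ n) (dir_deriv b \<phi>)"
proof (induction n)
  case (Suc n)
  then show ?case
    using dir_deriv_commute[OF smooth_funpow[OF assms(1,3)] assms(2,3)] by simp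
qed simp

lemma dir_deriv_commute_foldr:
  assumes "smooth \<phi>" "b \<in> Basis" "\<And>i. e i \<in> Basis"
  shows "dir_deriv b (foldr (\<lambda>i. dir_deriv (e i) ^^ \<alpha> i) js \<phi>)
       = foldr (\<lambda>i. dir_deriv (e i) ^^ \<alpha> i) js (dir_deriv b \<phi>)"
  using assms by (induction js) (auto simp: dir_deriv_commute_funpow smooth_foldr)

lemma dir_deriv_commute_mderiv:
  assumes "smooth \<phi>" "b \<in> Basis" "\<And>i. e i \<in> Basis"
  shows "dir_deriv b (mderiv e \<alpha> \<phi>) = mderiv e \<alpha> (dir_deriv b \<phi>)"
  unfolding mderiv_def by (rule dir_deriv_commute_foldr[OF assms])

lemma funpow_dir_deriv_commute_mderiv:
  assumes "smooth \<phi>" "b \<in> Basis" "\<And>i. e i \<in> Basis"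
  shows "(dir_deriv b ^^ n) (mderiv e \<alpha> \<phi>) = mderiv e \<alpha> ((dir_deriv b ^^ n) \<phi>)"
  using assms by (induction n) (auto simp: dir_deriv_commute_mderiv smooth_funpow)

text \<open>Derivatives of \<open>dirac0\<close> act by transposition: \<open>frame_x\<close>
  outside \<open>frame_y\<close> on the distribution becomes \<open>frame_y\<close> outside
  \<open>frame_x\<close> on the test function. This lemma restores the order that the two Taylor
  expansions produce.\<close>

lemma mderiv_commute:
  assumes "smooth \<phi>" "\<And>i. d i \<in> Basis" "\<And>i. e i \<in> Basis"
  shows "mderiv d \<beta> (mderiv e \<alpha> \<phi>) = mderiv e \<alpha> (mderiv d \<beta> \<phi>)"
proof -
  have "foldr (\<lambda>i. dir_deriv (d i) ^^ \<beta> i) js (mderiv e \<alpha> \<phi>)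
      = mderiv e \<alpha> (foldr (\<lambda>i. dir_deriv (d i) ^^ \<beta> i) js \<phi>)" for js
    using assms by (induction js) (auto simp: funpow_dir_deriv_commute_mderiv smooth_foldr)
  then show ?thesis unfolding mderiv_def[of d] .
qed

text \<open>Stated for an arbitrary distinct list because the list inside \<open>mderiv\<close> is
  known only through these properties. The extra derivative arises at the position of i and is
  commuted outwards.\<close>

lemma foldr_dir_deriv_Suc:
  assumes "smooth \<phi>" "\<And>i. e i \<in> Basis" "distinct js" "i \<in> set js"
  shows "foldr (\<lambda>j. dir_deriv (e j) ^^ (\<alpha>(i := Suc (\<alpha> i))) j) js \<phi>
       = dir_deriv (e i) (foldr (\<lambda>j. dir_deriv (e j) ^^ \<alpha> j) js \<phi>)"
  using assms(3,4)
proof (induction js)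
  case (Cons j js)
  show ?case
  proof (cases "i = j")
    case True
    with Cons.prems have "i \<notin> set js" by simp
    then have "foldr (\<lambda>j. dir_deriv (e j) ^^ (\<alpha>(i := Suc (\<alpha> i))) j) js \<phi>
        = foldr (\<lambda>j. dir_deriv (e j) ^^ \<alpha> j) js \<phi>"
      by (intro foldr_cong) auto
    with True show ?thesis by simp
  next
    case False
    with Cons show ?thesis
      by (simp add: dir_deriv_commute_funpow smooth_foldr assms(1,2))
  qed
qed simp

lemma mderiv_Suc:
  fixes e :: "'i::finite \<Rightarrow> 'a::euclidean_space"
  assumes "smooth \<phi>" "\<And>i. e i \<in> Basis"
  shows "mderiv e (\<alpha>(i := Suc (\<alpha> i))) \<phi> = dir_deriv (e i) (mderiv e \<alpha> \<phi>)"
proof -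
  have "\<exists>js. distinct js \<and> set js = (UNIV :: 'i set)"
    using finite_distinct_list[OF finite_class.finite_UNIV] by blast
  from someI_ex[OF this] show ?thesis
    unfolding mderiv_def by (intro foldr_dir_deriv_Suc assms) auto
qed

lemma mderiv_0: "mderiv e (\<lambda>_. 0) \<phi> = \<phi>"
proof -
  have "foldr (\<lambda>i. dir_deriv (e i) ^^ 0) js \<phi> = \<phi>" for js by (induction js) auto
  then show ?thesis unfolding mderiv_def .
qed

lemma dir_deriv_affine:
  assumes "smooth \<zeta>" "bounded_linear \<iota>"
  shows "dir_deriv v (\<lambda>z. c * \<zeta> (a + \<iota> z)) = (\<lambda>z. c * dir_deriv (\<iota> v) \<zeta> (a + \<iota> z))"
proof
  fix z
  interpret bounded_linear \<iota> by fact
  have "((\<lambda>z. c * \<zeta> (a + \<iota> z)) has_derivative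
      (\<lambda>v. c * frechet_derivative \<zeta> (at (a + \<iota> z)) (\<iota> v))) (at z)"
    by (rule has_derivative_mult_right has_derivative_compose[of "\<lambda>z. a + \<iota> z" _ z UNIV \<zeta>])+
       (auto intro!: derivative_eq_intros has_derivative_frechet assms has_derivative)
  from frechet_derivative_at[OF this]
  show "dir_deriv v (\<lambda>z. c * \<zeta> (a + \<iota> z)) z = c * dir_deriv (\<iota> v) \<zeta> (a + \<iota> z)"
    unfolding dir_deriv_def by (rule fun_cong[of _ _ v, OF sym])
qed

text \<open>Used for the slices \<open>x -> (x, 0)\<close> and \<open>y -> (x, y)\<close> through
  which \<open>distr_tensor\<close> sees a test function. The scalar c carries the sign
  \<open>(-1) ^ mdeg \<gamma>\<close> that the inner distribution derivative leaves in front of the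
  function of x.\<close>

lemma mderiv_affine:
  assumes "smooth \<zeta>" "bounded_linear \<iota>" "\<And>i. \<iota> (e i) \<in> Basis"
  shows "mderiv e \<alpha> (\<lambda>z. c * \<zeta> (a + \<iota> z)) = (\<lambda>z. c * mderiv (\<lambda>i. \<iota> (e i)) \<alpha> \<zeta> (a + \<iota> z))"
proof -
  have pow: "(dir_deriv (e i) ^^ n) (\<lambda>z. c * \<psi> (a + \<iota> z))
      = (\<lambda>z. c * (dir_deriv (\<iota> (e i)) ^^ n) \<psi> (a + \<iota> z))" if "smooth \<psi>" for \<psi> i n
    using that assms by (induction n) (auto simp: dir_deriv_affine smooth_funpow)
  have "foldr (\<lambda>i. dir_deriv (e i) ^^ \<alpha> i) js (\<lambda>z. c * \<zeta> (a + \<iota> z))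
      = (\<lambda>z. c * foldr (\<lambda>i. dir_deriv (\<iota> (e i)) ^^ \<alpha> i) js \<zeta> (a + \<iota> z))" for js
    using assms by (induction js) (auto simp: pow smooth_foldr)
  then show ?thesis unfolding mderiv_def .
qed

section \<open>Arithmetic of multi-indices\<close>

lemma mdeg_Suc: "mdeg (\<alpha>(i := Suc (\<alpha> i))) = Suc (mdeg \<alpha>)"
proof -
  have "(\<Sum>j\<in>UNIV - {i}. (\<alpha>(i := Suc (\<alpha> i))) j) = (\<Sum>j\<in>UNIV - {i}. \<alpha> j)"
    by (intro sum.cong) auto
  then show ?thesis
    unfolding mdeg_def by (simp only: sum.remove[OF finite_class.finite_UNIV UNIV_I, of _ i]) simp
qed

lemma mfact_Suc: "mfact (\<alpha>(i := Suc (\<alpha> i))) = real (Suc (\<alpha> i)) * mfact \<alpha>"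
proof -
  have "(\<Prod>j\<in>UNIV - {i}. (fact ((\<alpha>(i := Suc (\<alpha> i))) j) :: real)) = (\<Prod>j\<in>UNIV - {i}. (fact (\<alpha> j) :: real))"
    by (intro prod.cong) auto
  then show ?thesis
    unfolding mfact_def by (simp only: prod.remove[OF finite_class.finite_UNIV UNIV_I, of _ i]) simp
qed

lemma mpow_Suc: "mpow x (\<alpha>(i := Suc (\<alpha> i))) = x $ i * mpow x \<alpha>"
proof -
  have "(\<Prod>j\<in>UNIV - {i}. (x $ j) ^ (\<alpha>(i := Suc (\<alpha> i))) j) = (\<Prod>j\<in>UNIV - {i}. (x $ j) ^ \<alpha> j)"
    by (intro prod.cong) auto
  then show ?thesis
    unfolding mpow_def by (simp only: prod.remove[OF finite_class.finite_UNIV UNIV_I, of _ i]) simp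
qed

lemma mfact_pos: "mfact \<alpha> > 0"
  unfolding mfact_def by (simp add: prod_pos)

lemma mfact_nonzero [simp]: "mfact \<alpha> \<noteq> 0"
  using mfact_pos[of \<alpha>] by simp

lemma le_mdeg: "\<alpha> i \<le> mdeg \<alpha>"
  unfolding mdeg_def by (rule member_le_sum) auto

lemma finite_mdeg_le: "finite {\<alpha> :: 'i::finite \<Rightarrow> nat. mdeg \<alpha> \<le> k}"
proof (rule finite_subset)
  show "{\<alpha> :: 'i \<Rightarrow> nat. mdeg \<alpha> \<le> k} \<subseteq> (UNIV \<rightarrow>\<^sub>E {..k})"
    using le_mdeg order_trans by (fastforce simp: PiE_UNIV_domain)
qed (auto intro: finite_PiE)

lemma finite_mdeg_eq: "finite {\<alpha> :: 'i::finite \<Rightarrow> nat. mdeg \<alpha> = k}"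
  by (rule finite_subset[OF _ finite_mdeg_le[of k]]) auto

text \<open>Every index \<alpha> of degree j + 1 arises from \<alpha> - e_i with weight \<alpha>_i,
  because \<alpha>_i / \<alpha>! = 1 / (\<alpha> - e_i)!, and the weights add up to |\<alpha>| = j +
  1. This is the combinatorial core of Taylor's formula, with A standing for the
  derivatives.\<close>

lemma sum_mdeg_Suc:
  fixes y :: "real ^ 'i::finite" and A :: "('i \<Rightarrow> nat) \<Rightarrow> real"
  shows "(\<Sum>\<alpha> | mdeg \<alpha> = j. \<Sum>i\<in>UNIV. mpow y \<alpha> / mfact \<alpha> * (y $ i * A (\<alpha>(i := Suc (\<alpha> i)))))
       = real (Suc j) * (\<Sum>\<alpha> | mdeg \<alpha> = Suc j. mpow y \<alpha> / mfact \<alpha> * A \<alpha>)"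
proof -
  have inner: "(\<Sum>\<alpha> | mdeg \<alpha> = Suc j. real (\<alpha> i) * (mpow y \<alpha> / mfact \<alpha> * A \<alpha>))
      = (\<Sum>\<alpha> | mdeg \<alpha> = j. mpow y \<alpha> / mfact \<alpha> * (y $ i * A (\<alpha>(i := Suc (\<alpha> i)))))" for i
  proof -
    \<comment> \<open>Terms with \<alpha>_i = 0 have weight zero. Without them, lowering the i-th
      entry is a genuine inverse of raising it, in spite of truncated subtraction.\<close>
    have "(\<Sum>\<alpha> | mdeg \<alpha> = Suc j. real (\<alpha> i) * (mpow y \<alpha> / mfact \<alpha> * A \<alpha>))
        = (\<Sum>\<alpha> | mdeg \<alpha> = Suc j \<and> \<alpha> i \<noteq> 0. real (\<alpha> i) * (mpow y \<alpha> / mfact \<alpha> * A \<alpha>))"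
      by (rule sum.mono_neutral_right) (auto simp: finite_mdeg_eq)
    also have "\<dots> = (\<Sum>\<alpha> | mdeg \<alpha> = j. mpow y \<alpha> / mfact \<alpha> * (y $ i * A (\<alpha>(i := Suc (\<alpha> i)))))"
    proof (rule sum.reindex_bij_witness[of _ "\<lambda>\<alpha>. \<alpha>(i := Suc (\<alpha> i))" "\<lambda>\<alpha>. \<alpha>(i := \<alpha> i - 1)"])
      fix \<alpha> assume "\<alpha> \<in> {\<alpha>. mdeg \<alpha> = Suc j \<and> \<alpha> i \<noteq> 0}"
      then have \<alpha>: "mdeg \<alpha> = Suc j" and i: "\<alpha> i \<noteq> 0" by auto
      define \<alpha>' where "\<alpha>' = \<alpha>(i := \<alpha> i - 1)"
      have e: "\<alpha> = \<alpha>'(i := Suc (\<alpha>' i))" using i by (auto simp: \<alpha>'_def)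
      show "(\<alpha>(i := \<alpha> i - 1))(i := Suc ((\<alpha>(i := \<alpha> i - 1)) i)) = \<alpha>" using i by auto
      have "mdeg \<alpha>' = j" using \<alpha> mdeg_Suc[of \<alpha>' i] by (simp add: e[symmetric])
      then show "\<alpha>(i := \<alpha> i - 1) \<in> {\<alpha>. mdeg \<alpha> = j}" by (simp add: \<alpha>'_def)
      have "mpow y \<alpha>' / mfact \<alpha>' * (y $ i * A (\<alpha>'(i := Suc (\<alpha>' i))))
          = real (\<alpha> i) * (mpow y (\<alpha>'(i := Suc (\<alpha>' i))) / mfact (\<alpha>'(i := Suc (\<alpha>' i))) * A (\<alpha>'(i := Suc (\<alpha>' i))))"
        unfolding mpow_Suc mfact_Suc using i by (simp add: \<alpha>'_def)
      then show "mpow y (\<alpha>(i := \<alpha> i - 1)) / mfact (\<alpha>(i := \<alpha> i - 1))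
          * (y $ i * A ((\<alpha>(i := \<alpha> i - 1))(i := Suc ((\<alpha>(i := \<alpha> i - 1)) i))))
          = real (\<alpha> i) * (mpow y \<alpha> / mfact \<alpha> * A \<alpha>)"
        unfolding e[symmetric] unfolding \<alpha>'_def[symmetric] using e by simp
    qed (auto simp: mdeg_Suc)
    finally show ?thesis .
  qed
  have "real (Suc j) * (\<Sum>\<alpha> | mdeg \<alpha> = Suc j. mpow y \<alpha> / mfact \<alpha> * A \<alpha>)
      = (\<Sum>\<alpha> | mdeg \<alpha> = Suc j. \<Sum>i\<in>UNIV. real (\<alpha> i) * (mpow y \<alpha> / mfact \<alpha> * A \<alpha>))"
    unfolding sum_distrib_left
  proof (rule sum.cong[OF refl])
    fix \<alpha> :: "'i \<Rightarrow> nat" assume "\<alpha> \<in> {\<alpha>. mdeg \<alpha> = Suc j}"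
    then have "real (Suc j) = (\<Sum>i\<in>UNIV. real (\<alpha> i))"
      by (simp only: mdeg_def mem_Collect_eq flip: of_nat_sum)
    then show "real (Suc j) * (mpow y \<alpha> / mfact \<alpha> * A \<alpha>) =
        (\<Sum>i\<in>UNIV. real (\<alpha> i) * (mpow y \<alpha> / mfact \<alpha> * A \<alpha>))"
      by (simp only: sum_distrib_right)
  qed
  also have "\<dots> = (\<Sum>i\<in>UNIV. \<Sum>\<alpha> | mdeg \<alpha> = Suc j. real (\<alpha> i) * (mpow y \<alpha> / mfact \<alpha> * A \<alpha>))"
    by (rule sum.swap)
  also have "\<dots> = (\<Sum>\<alpha> | mdeg \<alpha> = j. \<Sum>i\<in>UNIV. mpow y \<alpha> / mfact \<alpha> * (y $ i * A (\<alpha>(i := Suc (\<alpha> i)))))"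
    unfolding inner by (rule sum.swap)
  finally show ?thesis by (rule sym)
qed

section \<open>Taylor's formula with integral remainder\<close>

lemma mpow_0: "mpow x (\<lambda>_. 0) = 1" "mfact (\<lambda>_. 0) = 1"
  by (simp_all add: mpow_def mfact_def)

lemma mdeg_eq_0_iff: "mdeg \<alpha> = 0 \<longleftrightarrow> \<alpha> = (\<lambda>_. 0)"
  by (auto simp: mdeg_def)

text \<open>The sum over |\<alpha>| = j is the j-th derivative of t -> \<phi>(a + t v) divided by
  j!, which explains the factor j + 1.\<close>

lemma taylor_term_has_derivative:
  fixes e :: "'i::finite \<Rightarrow> 'a::euclidean_space" and y :: "real ^ 'i"
  assumes \<phi>: "smooth \<phi>" and e: "\<And>i. e i \<in> Basis" and v: "v = (\<Sum>i\<in>UNIV. y $ i *\<^sub>R e i)"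
  shows "((\<lambda>t. \<Sum>\<alpha> | mdeg \<alpha> = j. mpow y \<alpha> / mfact \<alpha> * mderiv e \<alpha> \<phi> (a + t *\<^sub>R v)) has_real_derivative
    real (Suc j) * (\<Sum>\<alpha> | mdeg \<alpha> = Suc j. mpow y \<alpha> / mfact \<alpha> * mderiv e \<alpha> \<phi> (a + t *\<^sub>R v))) (at t)"
proof -
  have d: "dir_deriv v (mderiv e \<alpha> \<phi>) z = (\<Sum>i\<in>UNIV. y $ i * mderiv e (\<alpha>(i := Suc (\<alpha> i))) \<phi> z)" for z \<alpha>
  proof -
    have "linear (frechet_derivative (mderiv e \<alpha> \<phi>) (at z))"
      by (rule has_derivative_linear[OF has_derivative_frechet[OF smooth_mderiv]]) (use \<phi> e in auto)
    then show ?thesis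
      by (simp add: mderiv_Suc \<phi> e dir_deriv_def v linear_sum linear_scale)
  qed
  have "((\<lambda>t. \<Sum>\<alpha> | mdeg \<alpha> = j. mpow y \<alpha> / mfact \<alpha> * mderiv e \<alpha> \<phi> (a + t *\<^sub>R v)) has_real_derivative
    (\<Sum>\<alpha> | mdeg \<alpha> = j. mpow y \<alpha> / mfact \<alpha> * dir_deriv v (mderiv e \<alpha> \<phi>) (a + t *\<^sub>R v))) (at t)"
    by (rule DERIV_sum, rule DERIV_cmult, rule dir_deriv_along_line, rule smooth_differentiable,
        rule smooth_mderiv[OF \<phi> e])
  moreover have "(\<Sum>\<alpha> | mdeg \<alpha> = j. mpow y \<alpha> / mfact \<alpha> * dir_deriv v (mderiv e \<alpha> \<phi>) (a + t *\<^sub>R v))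
      = real (Suc j) * (\<Sum>\<alpha> | mdeg \<alpha> = Suc j. mpow y \<alpha> / mfact \<alpha> * mderiv e \<alpha> \<phi> (a + t *\<^sub>R v))"
    unfolding sum_mdeg_Suc[of y "\<lambda>\<alpha>. mderiv e \<alpha> \<phi> (a + t *\<^sub>R v)" j, symmetric]
    by (simp only: d sum_distrib_left)
  ultimately show ?thesis by simp
qed

text \<open>Since v only has to lie in the span of the frame, a frame of some of the coordinates
  gives the expansion in those variables. Both expansions are instances: \<open>frame_y\<close> at
  (x, 0) and \<open>frame_x\<close> at 0.\<close>

lemma taylor_mderiv:
  fixes e :: "'i::finite \<Rightarrow> 'a::euclidean_space" and y :: "real ^ 'i"
  assumes \<phi>: "smooth \<phi>" and e: "\<And>i. e i \<in> Basis" and v: "v = (\<Sum>i\<in>UNIV. y $ i *\<^sub>R e i)"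
  shows "\<phi> (a + v) = (\<Sum>\<alpha> | mdeg \<alpha> \<le> k. mpow y \<alpha> / mfact \<alpha> * mderiv e \<alpha> \<phi> a)
    + (\<Sum>\<alpha> | mdeg \<alpha> = Suc k. real (Suc k) / mfact \<alpha> *
         (mpow y \<alpha> * (LINT t:{0<..<1}|lborel. (1 - t) ^ k * mderiv e \<alpha> \<phi> (a + t *\<^sub>R v))))"
proof -
  define P where "P j t = (\<Sum>\<alpha> | mdeg \<alpha> = j. mpow y \<alpha> / mfact \<alpha> * mderiv e \<alpha> \<phi> (a + t *\<^sub>R v))" for j t
  have P: "(P j has_real_derivative real (Suc j) * P (Suc j) t) (at t)" for j t
    unfolding P_def using taylor_term_has_derivative[OF \<phi> e v] .
  have cont: "continuous_on S (\<lambda>t. mderiv e \<alpha> \<phi> (a + t *\<^sub>R v))" for S \<alpha>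
    by (intro continuous_on_compose2[OF smooth_continuous[OF smooth_mderiv[OF \<phi> e], of UNIV]] continuous_intros) auto
  \<comment> \<open>This is the Taylor polynomial with centre a + t v, evaluated at a + v. It runs
    from the polynomial at t = 0 to the value at t = 1, and its derivative telescopes to a single
    term, so one use of the fundamental theorem replaces repeated integration by parts.\<close>
  define G where "G t = (\<Sum>j\<le>k. (1 - t) ^ j * P j t)" for t
  have G: "(G has_real_derivative real (Suc k) * (1 - t) ^ k * P (Suc k) t) (at t)" for t
    unfolding G_def
  proof (induction k)
    case 0
    then show ?case using P[of 0 t] by simp
  next
    case (Suc k)
    have "((\<lambda>t. (1 - t) ^ Suc k * P (Suc k) t) has_real_derivative
        (1 - t) ^ Suc k * (real (Suc (Suc k)) * P (Suc (Suc k)) t) - real (Suc k) * (1 - t) ^ k * P (Suc k) t) (at t)"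
      by (rule derivative_eq_intros P refl | simp)+
    from DERIV_add[OF Suc this] show ?case by (simp add: algebra_simps)
  qed
  have "(LBINT t. indicator {0..1} t *\<^sub>R (real (Suc k) * (1 - t) ^ k * P (Suc k) t)) = G 1 - G 0"
  proof (rule integral_FTC_atLeastAtMost)
    show "(G has_vector_derivative real (Suc k) * (1 - t) ^ k * P (Suc k) t) (at t within {0..1})" for t
      using has_vector_derivative_at_within[OF G[unfolded has_real_derivative_iff_has_vector_derivative]] .
    show "continuous_on {0..1} (\<lambda>t. real (Suc k) * (1 - t) ^ k * P (Suc k) t)"
      unfolding P_def by (intro continuous_intros cont) simp
  qed simp
  \<comment> \<open>Only j = 0 survives at t = 1, by the convention 0 ^ 0 = 1.\<close>
  moreover have "G 1 = P 0 1"
    by (simp add: G_def power_0_left if_distrib[of "\<lambda>z. z * _"] cong: if_cong)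
  moreover have "P 0 1 = \<phi> (a + v)"
    by (simp add: P_def mdeg_eq_0_iff mpow_0 mderiv_0)
  moreover have "G 0 = (\<Sum>\<alpha> | mdeg \<alpha> \<le> k. mpow y \<alpha> / mfact \<alpha> * mderiv e \<alpha> \<phi> a)"
  proof -
    have "(\<Sum>j\<le>k. \<Sum>\<alpha> | mdeg \<alpha> = j. h \<alpha>) = (\<Sum>\<alpha> | mdeg \<alpha> \<le> k. h \<alpha>)" for h :: "('i \<Rightarrow> nat) \<Rightarrow> real"
    proof -
      have "(\<Sum>j\<le>k. \<Sum>\<alpha> | mdeg \<alpha> = j. h \<alpha>) = (\<Sum>j\<le>k. \<Sum>\<alpha> | \<alpha> \<in> {\<alpha>. mdeg \<alpha> \<le> k} \<and> mdeg \<alpha> = j. h \<alpha>)"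
        by (intro sum.cong) auto
      then show ?thesis by (simp only:) (rule sum.group; auto simp: finite_mdeg_le)
    qed
    then show ?thesis by (simp add: G_def P_def)
  qed
  moreover have "(LBINT t. indicator {0..1} t *\<^sub>R (real (Suc k) * (1 - t) ^ k * P (Suc k) t))
     = (\<Sum>\<alpha> | mdeg \<alpha> = Suc k. real (Suc k) / mfact \<alpha> *
         (mpow y \<alpha> * (LINT t:{0<..<1}|lborel. (1 - t) ^ k * mderiv e \<alpha> \<phi> (a + t *\<^sub>R v))))"
  proof -
    have int: "integrable lborel (\<lambda>t. indicator {0..1} t *\<^sub>R ((1 - t) ^ k * mderiv e \<alpha> \<phi> (a + t *\<^sub>R v)))" for \<alpha>
      by (intro borel_integrable_compact continuous_intros cont) auto
    \<comment> \<open>The fundamental theorem is used on the closed interval, while the remainders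
      are integrals over the open one, where t > 0 makes the dilation by 1/t meaningful. The
      endpoints are null.\<close>
    have io: "(LINT t:{0<..<1}|lborel. (1 - t) ^ k * mderiv e \<alpha> \<phi> (a + t *\<^sub>R v))
        = (LBINT t. indicator {0..1} t *\<^sub>R ((1 - t) ^ k * mderiv e \<alpha> \<phi> (a + t *\<^sub>R v)))" for \<alpha>
    proof -
      have "AE t in lborel. t \<noteq> 0 \<and> t \<noteq> (1::real)"
        using AE_lborel_singleton[of "0::real"] AE_lborel_singleton[of "1::real"] by auto
      then have "AE t in lborel. indicator {0<..<1} t *\<^sub>R ((1 - t) ^ k * mderiv e \<alpha> \<phi> (a + t *\<^sub>R v))
          = indicator {0..1} t *\<^sub>R ((1 - t) ^ k * mderiv e \<alpha> \<phi> (a + t *\<^sub>R v))"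
        by eventually_elim (auto simp: indicator_def)
      moreover have "(\<lambda>t. mderiv e \<alpha> \<phi> (a + t *\<^sub>R v)) \<in> borel_measurable borel"
        by (intro borel_measurable_continuous_onI cont)
      ultimately show ?thesis unfolding set_lebesgue_integral_def
        by (intro integral_cong_AE) auto
    qed
    have "(LBINT t. indicator {0..1} t *\<^sub>R (real (Suc k) * (1 - t) ^ k * P (Suc k) t))
      = (LBINT t. \<Sum>\<alpha> | mdeg \<alpha> = Suc k. (real (Suc k) * mpow y \<alpha> / mfact \<alpha>) *
           (indicator {0..1} t *\<^sub>R ((1 - t) ^ k * mderiv e \<alpha> \<phi> (a + t *\<^sub>R v))))"
      unfolding P_def by (simp add: sum_distrib_left mult_ac)
    also have "\<dots> = (\<Sum>\<alpha> | mdeg \<alpha> = Suc k. (real (Suc k) * mpow y \<alpha> / mfact \<alpha>) *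
           (LBINT t. indicator {0..1} t *\<^sub>R ((1 - t) ^ k * mderiv e \<alpha> \<phi> (a + t *\<^sub>R v))))"
      using int by (subst Bochner_Integration.integral_sum) (auto intro!: Bochner_Integration.integrable_mult_right simp del: of_nat_Suc)
    finally show ?thesis unfolding io by (simp add: mult_ac)
  qed
  ultimately show ?thesis by simp
qed

section \<open>Bounded functions of bounded support\<close>

text \<open>A class of integrable functions closed under what is done to f: multiplication by
  continuous functions, absolute powers, slices and partial integration. Asking for measurability
  instead of continuity spares continuity proofs for integrals depending on a parameter.\<close>

definition bdd_supp :: "('a::euclidean_space \<Rightarrow> real) \<Rightarrow> bool" where
  "bdd_supp u \<longleftrightarrow> u \<in> borel_measurable borel \<and> bounded (range u) \<and> bounded {z. u z \<noteq> 0}"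

lemma bdd_suppI:
  assumes "u \<in> borel_measurable borel" "\<And>z. \<bar>u z\<bar> \<le> C" "\<And>z. u z \<noteq> 0 \<Longrightarrow> norm z \<le> R"
  shows "bdd_supp u"
  unfolding bdd_supp_def bounded_iff using assms by auto

lemma bdd_suppE:
  assumes "bdd_supp u"
  obtains C R where "0 \<le> C" "\<And>z. \<bar>u z\<bar> \<le> C" "\<And>z. u z \<noteq> 0 \<Longrightarrow> norm z \<le> R"
proof -
  obtain C R where "\<And>z. \<bar>u z\<bar> \<le> C" "\<And>z. u z \<noteq> 0 \<Longrightarrow> norm z \<le> R"
    using assms unfolding bdd_supp_def bounded_iff by auto
  moreover from this have "0 \<le> C" by (metis abs_ge_zero order_trans)
  ultimately show ?thesis by (rule that[rotated])
qed

lemma bdd_supp_measurable: "bdd_supp u \<Longrightarrow> u \<in> borel_measurable borel"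
  by (simp add: bdd_supp_def)

lemma bdd_supp_le_indicator:
  assumes "bdd_supp u"
  obtains C R where "0 \<le> C" "\<And>z. \<bar>u z\<bar> \<le> C * indicator (cball 0 R) z"
proof -
  obtain C R where "0 \<le> C" "\<And>z. \<bar>u z\<bar> \<le> C" "\<And>z. u z \<noteq> 0 \<Longrightarrow> norm z \<le> R"
    using assms by (rule bdd_suppE) blast
  then show ?thesis by (intro that[of C R]) (auto simp: indicator_def)
qed

lemma integrable_cball_indicator: "integrable lborel (\<lambda>z::'a::euclidean_space. C * indicator (cball 0 R) z :: real)"
  using emeasure_bounded_finite[OF bounded_cball, of 0 R]
  by (intro integrable_mult_right integrable_real_indicator) (auto simp: top.not_eq_extremum)

lemma bdd_supp_integrable:
  assumes "bdd_supp u"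
  shows "integrable lborel u"
proof -
  obtain C R where "0 \<le> C" and u: "\<And>z. \<bar>u z\<bar> \<le> C * indicator (cball 0 R) z"
    using bdd_supp_le_indicator[OF assms] by blast
  show ?thesis
    by (rule Bochner_Integration.integrable_bound[OF integrable_cball_indicator[of C R]])
       (use bdd_supp_measurable[OF assms] in \<open>auto intro!: AE_I2 order_trans[OF u]\<close>)
qed

lemma bdd_supp_continuous:
  assumes "continuous_on UNIV u" "compact (closure {z. u z \<noteq> 0})"
  shows "bdd_supp u"
proof -
  have "bounded (u ` closure {z. u z \<noteq> 0})"
    using assms by (intro compact_imp_bounded compact_continuous_image) (auto intro: continuous_on_subset)
  then have "bounded (insert 0 (u ` closure {z. u z \<noteq> 0}))" by simp
  moreover have "range u \<subseteq> insert 0 (u ` closure {z. u z \<noteq> 0})"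
    using closure_subset by fastforce
  moreover have "bounded {z. u z \<noteq> 0}"
    using assms(2) by (metis bounded_subset closure_subset compact_imp_bounded)
  ultimately show ?thesis
    unfolding bdd_supp_def using assms(1) bounded_subset borel_measurable_continuous_onI by blast
qed

text \<open>The factor g may grow at infinity, as monomials do: only its values on a ball containing
  the support of u matter, and there it is bounded by compactness.\<close>

lemma bdd_supp_mult_continuous:
  assumes "continuous_on UNIV g" "bdd_supp u"
  shows "bdd_supp (\<lambda>z. g z * u z)"
proof -
  obtain C R where C: "0 \<le> C" "\<And>z. \<bar>u z\<bar> \<le> C" and R: "\<And>z. u z \<noteq> 0 \<Longrightarrow> norm z \<le> R"
    using assms(2) by (rule bdd_suppE) blast
  have "bounded (g ` cball 0 R)"
    using assms(1) by (intro compact_imp_bounded compact_continuous_image) (auto intro: continuous_on_subset)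
  then obtain D where "\<forall>z\<in>cball 0 R. \<bar>g z\<bar> \<le> D"
    unfolding bounded_iff by auto
  then have D: "norm z \<le> R \<Longrightarrow> \<bar>g z\<bar> \<le> D" for z by simp
  show ?thesis
  proof (rule bdd_suppI)
    show "(\<lambda>z. g z * u z) \<in> borel_measurable borel"
      using assms bdd_supp_measurable borel_measurable_continuous_onI by (intro borel_measurable_times) auto
    show "\<bar>g z * u z\<bar> \<le> \<bar>D\<bar> * C" for z
    proof (cases "u z = 0")
      case False
      with D[OF R] C show ?thesis unfolding abs_mult by (intro mult_mono) force+
    qed (use C in auto)
    show "norm z \<le> R" if "g z * u z \<noteq> 0" for z using that R by auto
  qed
qed

lemma bdd_supp_abs: "bdd_supp u \<Longrightarrow> bdd_supp (\<lambda>z. \<bar>u z\<bar>)"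
  by (auto simp: bdd_supp_def bounded_iff)

lemma bdd_supp_abs_powr:
  assumes "bdd_supp u" "p > 0"
  shows "bdd_supp (\<lambda>z. \<bar>u z\<bar> powr p)"
proof -
  obtain C R where C: "0 \<le> C" "\<And>z. \<bar>u z\<bar> \<le> C" and R: "\<And>z. u z \<noteq> 0 \<Longrightarrow> norm z \<le> R"
    using assms(1) by (rule bdd_suppE) blast
  have [measurable]: "u \<in> borel_measurable borel" using assms(1) by (rule bdd_supp_measurable)
  show ?thesis
  proof (rule bdd_suppI)
    show "\<bar>\<bar>u z\<bar> powr p\<bar> \<le> C powr p" for z
      using C assms(2) by (simp add: powr_mono2)
    show "norm z \<le> R" if "\<bar>u z\<bar> powr p \<noteq> 0" for z using that R by auto
  qed measurable
qed

lemma bdd_supp_slice: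
  assumes "bdd_supp f"
  shows "bdd_supp (\<lambda>y. f (x, y))"
proof -
  obtain C R where C: "0 \<le> C" "\<And>z. \<bar>f z\<bar> \<le> C" and R: "\<And>z. f z \<noteq> 0 \<Longrightarrow> norm z \<le> R"
    using assms by (rule bdd_suppE) blast
  have [measurable]: "f \<in> borel_measurable borel" using assms by (rule bdd_supp_measurable)
  have "norm y \<le> R" if "f (x, y) \<noteq> 0" for y
    using R[OF that] norm_snd_le[of y x] by linarith
  then show ?thesis by (intro bdd_suppI[of _ C R]) (use C in auto)
qed

text \<open>One majorant \<open>C * indicator (cball 0 R) y\<close> serves every slice, so its
  integral bounds the partial integral uniformly in x.\<close>

lemma bdd_supp_integral:
  fixes f :: "'a::euclidean_space \<times> 'b::euclidean_space \<Rightarrow> real"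
  assumes "bdd_supp f"
  shows "bdd_supp (\<lambda>x. \<integral>y. f (x, y) \<partial>lborel)"
proof -
  obtain C R where C: "0 \<le> C" "\<And>z. \<bar>f z\<bar> \<le> C" and R: "\<And>z. f z \<noteq> 0 \<Longrightarrow> norm z \<le> R"
    using assms by (rule bdd_suppE) blast
  have [measurable]: "f \<in> borel_measurable borel" using assms by (rule bdd_supp_measurable)
  have le: "\<bar>f (x, y)\<bar> \<le> C * indicator (cball 0 R) y" for x y
    using C R[of "(x, y)"] norm_snd_le[of y x] by (cases "f (x, y) = 0") (auto simp: indicator_def)
  show ?thesis
  proof (rule bdd_suppI)
    show "(\<lambda>x. \<integral>y. f (x, y) \<partial>lborel) \<in> borel_measurable borel"
      by measurable
    show "\<bar>\<integral>y. f (x, y) \<partial>lborel\<bar> \<le> (\<integral>y. C * indicator (cball 0 R) y \<partial>(lborel :: 'b measure))" for x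
    proof -
      have "\<bar>\<integral>y. f (x, y) \<partial>lborel\<bar> \<le> (\<integral>y. \<bar>f (x, y)\<bar> \<partial>lborel)" by (rule integral_abs_bound)
      also have "\<dots> \<le> (\<integral>y. C * indicator (cball 0 R) y \<partial>(lborel :: 'b measure))"
        by (rule integral_mono[OF bdd_supp_integrable integrable_cball_indicator le])
          (intro bdd_supp_abs bdd_supp_slice assms)
      finally show ?thesis .
    qed
    show "norm x \<le> R" if "(\<integral>y. f (x, y) \<partial>lborel) \<noteq> 0" for x
    proof -
      have "\<exists>y. f (x, y) \<noteq> 0" using that by (rule contrapos_np) simp
      then show ?thesis using R norm_fst_le order_trans by blast
    qed
  qed
qed

section \<open>Averages over dilations\<close>

lemma powr_above_tangent:
  fixes a b p :: real
  assumes "0 \<le> a" "0 \<le> b" "1 \<le> p"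
  shows "a powr p + p * a powr (p - 1) * (b - a) \<le> b powr p"
\<comment> \<open>The tangent argument works on the open half-line only. The boundary cases rest on
  p >= 1 and on \<open>0 powr q = 0\<close> for every q, including q = 0, which occurs for p =
  1.\<close>
proof (cases "a = 0 \<or> b = 0")
  case True
  have "a powr (p - 1) * a = a powr p" if "b = 0"
    using assms(1) by (cases "a = 0") (auto simp: powr_mult_base mult.commute)
  then have "p * a powr (p - 1) * a = p * a powr p" if "b = 0" using that by simp
  moreover have "a powr p \<le> p * a powr p" using assms(3) mult_right_mono[of 1 p "a powr p"] by simp
  ultimately show ?thesis using True assms(2) by (auto simp: right_diff_distrib mult.assoc)
next
  case False
  then have "a > 0" "b > 0" using assms by auto
  then have "b powr p - a powr p \<ge> p * a powr (p - 1) * (b - a)"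
    using assms(3)
    by (intro convex_on_imp_above_tangent[of "{0<..}" "\<lambda>x. x powr p"] powr_convex)
       (auto intro!: derivative_eq_intros simp: interior_open)
  then show ?thesis by linarith
qed

text \<open>The tangent inequality for s -> s^p at the weighted mean a = I / B is multiplied by w
  and integrated; its linear part then integrates to zero. The total mass B is not scaled to 1,
  whence the factor B^(p-1).\<close>

lemma weighted_jensen_powr:
  fixes w g :: "'a \<Rightarrow> real"
  assumes w: "integrable M w" "\<And>t. 0 \<le> w t" and B: "B = (\<integral>t. w t \<partial>M)" "B > 0"
    and g: "\<And>t. 0 \<le> g t" "integrable M (\<lambda>t. w t * g t)" "integrable M (\<lambda>t. w t * g t powr p)" and p: "1 \<le> p"
  shows "(\<integral>t. w t * g t \<partial>M) powr p \<le> B powr (p - 1) * (\<integral>t. w t * g t powr p \<partial>M)"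
proof -
  define I where "I = (\<integral>t. w t * g t \<partial>M)"
  have I: "I \<ge> 0" unfolding I_def using w g by (intro Bochner_Integration.integral_nonneg) auto
  define a where "a = I / B"
  have a: "a \<ge> 0" using I B(2) by (simp add: a_def)
  have int: "integrable M (\<lambda>t. a powr p * w t + p * a powr (p - 1) * (w t * g t - a * w t))"
    using w(1) g(2) by simp
  have "a powr p * B = a powr p * B + p * a powr (p - 1) * (I - a * B)"
    using B(2) by (simp add: a_def)
  also have "\<dots> = (\<integral>t. a powr p * w t + p * a powr (p - 1) * (w t * g t - a * w t) \<partial>M)"
    using w(1) g(2) by (simp add: I_def B)
  also have "\<dots> \<le> (\<integral>t. w t * g t powr p \<partial>M)"
  proof (rule integral_mono[OF int g(3)])
    fix t
    show "a powr p * w t + p * a powr (p - 1) * (w t * g t - a * w t) \<le> w t * g t powr p"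
      using mult_left_mono[OF powr_above_tangent[OF a g(1) p] w(2), of t t] by (simp add: algebra_simps)
  qed
  finally have "B powr (p - 1) * (a powr p * B) \<le> B powr (p - 1) * (\<integral>t. w t * g t powr p \<partial>M)"
    by (rule mult_left_mono) simp
  moreover have "B powr (p - 1) * (a powr p * B) = I powr p"
    using B(2) I by (simp add: a_def powr_divide powr_diff)
  ultimately show ?thesis by (simp add: I_def)
qed

text \<open>Without integrability the inequality is trivial: its left-hand side is then \<open>0\<close> or its
  right-hand side \<open>\<infinity>\<close>.\<close>

lemma weighted_jensen_powr_nn_integral:
  fixes w h :: "'a \<Rightarrow> real"
  assumes w: "integrable M w" "\<And>t. 0 \<le> w t" and B: "B = (\<integral>t. w t \<partial>M)" "B > 0"
    and h[measurable]: "h \<in> borel_measurable M" and p: "1 \<le> p"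
  shows "ennreal (\<bar>\<integral>t. w t * h t \<partial>M\<bar> powr p)
    \<le> ennreal (B powr (p - 1)) * (\<integral>\<^sup>+t. ennreal (w t * \<bar>h t\<bar> powr p) \<partial>M)"
proof (cases "integrable M (\<lambda>t. w t * h t) \<and> integrable M (\<lambda>t. w t * \<bar>h t\<bar> powr p)")
  case True
  then have "integrable M (\<lambda>t. \<bar>w t * h t\<bar>)" by (intro integrable_abs) simp
  then have int: "integrable M (\<lambda>t. w t * \<bar>h t\<bar>)" using w(2) by (simp add: abs_mult)
  have "\<bar>\<integral>t. w t * h t \<partial>M\<bar> \<le> (\<integral>t. w t * \<bar>h t\<bar> \<partial>M)"
    using integral_abs_bound[of M "\<lambda>t. w t * h t"] w(2) by (simp add: abs_mult)
  then have "\<bar>\<integral>t. w t * h t \<partial>M\<bar> powr p \<le> (\<integral>t. w t * \<bar>h t\<bar> \<partial>M) powr p"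
    using p by (intro powr_mono2) auto
  also have "\<dots> \<le> B powr (p - 1) * (\<integral>t. w t * \<bar>h t\<bar> powr p \<partial>M)"
    by (rule weighted_jensen_powr[OF w B _ int _ p]) (use True in auto)
  finally show ?thesis
    using True w(2) by (simp add: nn_integral_eq_integral ennreal_leI flip: ennreal_mult')
next
  case False
  have [measurable]: "w \<in> borel_measurable M" using w(1) by simp
  show ?thesis
  proof (cases "integrable M (\<lambda>t. w t * h t)")
    case True
    with False have "\<not> integrable M (\<lambda>t. w t * \<bar>h t\<bar> powr p)" by blast
    then have "(\<integral>\<^sup>+t. ennreal (w t * \<bar>h t\<bar> powr p) \<partial>M) = \<infinity>"
      using w(2) by (simp add: integrable_iff_bounded not_less top_unique)
    then show ?thesis using B(2) by (simp add: ennreal_mult_top)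
  qed (simp add: not_integrable_integral_eq)
qed

text \<open>This provides the weight for Jensen's inequality, with a = 1 - d + d/p; the condition a
  > 0 is integrability at t = 0. As the weight is nonnegative, its gauge integral carries over to
  the Lebesgue integral.\<close>

lemma
  fixes a :: real
  assumes "a > 0"
  shows integrable_Beta_Ioo: "integrable lborel (\<lambda>t. indicator {0<..<1} t * ((1 - t) ^ j * t powr (a - 1)))"
    and integral_Beta_Ioo: "(\<integral>t. indicator {0<..<1} t * ((1 - t) ^ j * t powr (a - 1)) \<partial>lborel) = Beta (real j + 1) a"
proof -
  let ?w = "\<lambda>t::real. indicator {0<..<1} t * ((1 - t) ^ j * t powr (a - 1)) :: real"
  have "((\<lambda>t. t powr (a - 1) * (1 - t) powr (real j + 1 - 1)) has_integral Beta a (real j + 1)) {0<..<1}"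
    using has_integral_Beta_real[OF assms, of "real j + 1"] by (simp add: has_integral_Icc_iff_Ioo)
  then have "((\<lambda>t. (1 - t) ^ j * t powr (a - 1)) has_integral Beta a (real j + 1)) {0<..<1}"
    by (rule has_integral_eq[rotated]) (auto simp: powr_realpow)
  then have hi: "(?w has_integral Beta a (real j + 1)) UNIV"
    unfolding has_integral_restrict_UNIV[of "{0<..<1}", symmetric]
    by (rule has_integral_eq[rotated]) (simp add: indicator_def)
  have w0: "?w t \<ge> 0" for t by (auto simp: indicator_def)
  have nn: "(\<integral>\<^sup>+t. ennreal (?w t) \<partial>lborel) = ennreal (Beta a (real j + 1))"
    by (rule nn_integral_has_integral_lborel[OF _ w0 hi]) measurable
  show int: "integrable lborel ?w"
    by (rule integrableI_nonneg) (use w0 nn in auto)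
  show "integral\<^sup>L lborel ?w = Beta (real j + 1) a"
    using has_integral_unique[OF has_integral_integral_lborel[OF int] hi] by (simp add: Beta_commute)
qed

text \<open>Tonelli with the z-integral innermost: a kernel that is singular as t tends to 0 can
  still have slices of bounded L^1 norm, and the unit interval has mass 1.\<close>

lemma integrable_lborel_pair_if_slices_le:
  fixes K :: "real \<times> 'z::euclidean_space \<Rightarrow> real"
  assumes [measurable]: "K \<in> borel_measurable (lborel \<Otimes>\<^sub>M lborel)"
    and le: "\<And>t. (\<integral>\<^sup>+z. ennreal \<bar>K (t, z)\<bar> \<partial>lborel) \<le> indicator {0<..<1} t * ennreal C"
  shows "integrable (lborel \<Otimes>\<^sub>M lborel) K"
proof (rule integrableI_bounded)
  have "(\<integral>\<^sup>+x. ennreal (norm (K x)) \<partial>(lborel \<Otimes>\<^sub>M lborel)) = (\<integral>\<^sup>+t. \<integral>\<^sup>+z. ennreal \<bar>K (t, z)\<bar> \<partial>lborel \<partial>lborel)"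
    by (subst lborel.nn_integral_fst[symmetric]) auto
  also have "\<dots> \<le> (\<integral>\<^sup>+t. indicator {0<..<1::real} t * ennreal C \<partial>lborel)"
    by (intro nn_integral_mono le)
  also have "\<dots> = ennreal C" by (simp add: nn_integral_multc)
  finally show "(\<integral>\<^sup>+x. ennreal (norm (K x)) \<partial>(lborel \<Otimes>\<^sub>M lborel)) < \<infinity>"
    by (simp add: le_less_trans)
qed measurable

text \<open>The number d is the exponent of the Jacobian, not the dimension of the space: dilating
  only y in (x, y) gives d = n in dimension m + n. The change of variables is stated for nonnegative
  integrals, so that it is available before integrability is known.\<close>

locale dilation =
  fixes S :: "real \<Rightarrow> 'z::euclidean_space \<Rightarrow> 'z" and d :: nat
  assumes measurable_dilation: "(\<lambda>(t, z). S t z) \<in> borel_measurable (borel \<Otimes>\<^sub>M borel)"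
    and dilation_inverse: "t > 0 \<Longrightarrow> S t (S (inverse t) z) = z"
    and nn_integral_dilation: "t > 0 \<Longrightarrow> H \<in> borel_measurable borel \<Longrightarrow>
      (\<integral>\<^sup>+z. H (S (inverse t) z) \<partial>lborel) = ennreal (t ^ d) * (\<integral>\<^sup>+z. H z \<partial>lborel)"
begin

lemma measurable_dilation_comp [measurable (raw)]:
  assumes [measurable]: "g \<in> borel_measurable M" "h \<in> borel_measurable M"
  shows "(\<lambda>x. S (g x) (h x)) \<in> borel_measurable M"
  using measurable_compose[OF measurable_Pair[OF assms] measurable_dilation] by simp

text \<open>Proved as an identity of measures: the image of Lebesgue measure under
  \<open>S (inverse t)\<close> is t^d times Lebesgue measure. It therefore holds for every
  measurable H, integrable or not.\<close>

lemma integral_dilation: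
  fixes H :: "'z \<Rightarrow> real"
  assumes t: "t > 0" and [measurable]: "H \<in> borel_measurable borel"
  shows "(\<integral>z. H (S (inverse t) z) \<partial>lborel) = t ^ d * (\<integral>z. H z \<partial>lborel)"
proof -
  have m: "S (inverse t) \<in> borel \<rightarrow>\<^sub>M borel" by measurable
  have "distr lborel borel (S (inverse t)) = density lborel (\<lambda>_. ennreal (t ^ d))"
  proof (rule measure_eqI)
    fix A :: "'z set" assume "A \<in> sets (distr lborel borel (S (inverse t)))"
    then have [measurable]: "A \<in> sets borel" by simp
    have "emeasure (distr lborel borel (S (inverse t))) A = (\<integral>\<^sup>+z. indicator A (S (inverse t) z) \<partial>lborel)"
      using m by (simp add: nn_integral_distr flip: nn_integral_indicator)
    also have "\<dots> = emeasure (density lborel (\<lambda>_. ennreal (t ^ d))) A"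
      using t by (simp add: nn_integral_dilation emeasure_density nn_integral_cmult)
    finally show "emeasure (distr lborel borel (S (inverse t))) A
      = emeasure (density lborel (\<lambda>_. ennreal (t ^ d))) A" .
  qed simp
  then have "(\<integral>z. H z \<partial>distr lborel borel (S (inverse t))) = (\<integral>z. H z \<partial>density lborel (\<lambda>_. ennreal (t ^ d)))"
    by simp
  then show ?thesis
    using t m by (simp add: integral_distr integral_density)
qed

definition average :: "nat \<Rightarrow> ('z \<Rightarrow> real) \<Rightarrow> 'z \<Rightarrow> real" where
  "average j u z = (LINT t:{0<..<1}|lborel. (1 - t) ^ j * u (S (inverse t) z) / t ^ d)"

lemma borel_measurable_average [measurable]:
  assumes [measurable]: "u \<in> borel_measurable borel"
  shows "average j u \<in> borel_measurable borel"
  unfolding average_def set_lebesgue_integral_def by measurable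

text \<open>The transpose of \<open>average j\<close> integrates \<psi>(S t z) over t: the
  substitution z -> S t z is made for fixed t, between two exchanges of integrals. Both kernels have
  t-slices of L^1 norm at most \<open>C * U\<close>, with U the L^1 norm of u; for K this is because
  the Jacobian t^d absorbs t^(-d).\<close>

lemma
  assumes u: "integrable lborel u" and [measurable]: "\<psi> \<in> borel_measurable borel"
    and \<psi>: "\<And>z. \<bar>\<psi> z\<bar> \<le> C"
  shows integrable_mult_average:
      "integrable lborel (\<lambda>z. u z * (LINT t:{0<..<1}|lborel. (1 - t) ^ j * \<psi> (S t z)))"
    and integral_average_mult: "(\<integral>z. average j u z * \<psi> z \<partial>lborel)
       = (\<integral>z. u z * (LINT t:{0<..<1}|lborel. (1 - t) ^ j * \<psi> (S t z)) \<partial>lborel)"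
proof -
  have [measurable]: "u \<in> borel_measurable borel" using u by simp
  have C: "0 \<le> C" using \<psi> abs_ge_zero order_trans by blast
  define U where "U = (\<integral>z. \<bar>u z\<bar> \<partial>lborel)"
  have U: "(\<integral>\<^sup>+z. ennreal \<bar>u z\<bar> \<partial>lborel) = ennreal U"
    unfolding U_def using u by (intro nn_integral_eq_integral) auto
  define K where "K t z = indicator {0<..<1} t * ((1 - t) ^ j * u (S (inverse t) z) / t ^ d * \<psi> z)" for t z
  define L where "L t z = indicator {0<..<1} t * ((1 - t) ^ j * (u z * \<psi> (S t z)))" for t z
  have p1: "(1 - t) ^ j \<le> 1" if "t \<in> {0<..<1}" for t :: real
    using that by (simp add: power_le_one)
  have intK: "integrable (lborel \<Otimes>\<^sub>M lborel) (\<lambda>(t, z). K t z)"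
  proof (rule integrable_lborel_pair_if_slices_le)
    show "(\<lambda>(t, z). K t z) \<in> borel_measurable (lborel \<Otimes>\<^sub>M lborel)"
      unfolding K_def by measurable
    fix t :: real
    show "(\<integral>\<^sup>+z. ennreal \<bar>(\<lambda>(t, z). K t z) (t, z)\<bar> \<partial>lborel) \<le> indicator {0<..<1} t * ennreal (C * U)"
    proof (cases "t \<in> {0<..<1}")
      case True
      have "\<bar>K t z\<bar> \<le> C / t ^ d * \<bar>u (S (inverse t) z)\<bar>" for z
      proof -
        have "\<bar>K t z\<bar> = (1 - t) ^ j * (\<bar>u (S (inverse t) z)\<bar> / t ^ d) * \<bar>\<psi> z\<bar>"
          using True by (simp add: K_def abs_mult)
        also have "\<dots> \<le> 1 * (\<bar>u (S (inverse t) z)\<bar> / t ^ d) * C"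
          using True C by (intro mult_mono p1 \<psi>) auto
        finally show ?thesis by (simp add: mult_ac)
      qed
      then have "(\<integral>\<^sup>+z. ennreal \<bar>K t z\<bar> \<partial>lborel) \<le> (\<integral>\<^sup>+z. ennreal (C / t ^ d) * ennreal \<bar>u (S (inverse t) z)\<bar> \<partial>lborel)"
        using True C by (intro nn_integral_mono) (simp add: ennreal_leI flip: ennreal_mult)
      also have "\<dots> = ennreal (C / t ^ d) * (ennreal (t ^ d) * ennreal U)"
        using True nn_integral_dilation[of t "\<lambda>z. ennreal \<bar>u z\<bar>"] by (simp add: nn_integral_cmult U)
      also have "\<dots> = ennreal (C * U)"
        using True C by (simp add: U_def flip: ennreal_mult)
      finally show ?thesis using True by simp
    qed (simp add: K_def)
  qed
  have intL: "integrable (lborel \<Otimes>\<^sub>M lborel) (\<lambda>(t, z). L t z)"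
  proof (rule integrable_lborel_pair_if_slices_le)
    show "(\<lambda>(t, z). L t z) \<in> borel_measurable (lborel \<Otimes>\<^sub>M lborel)"
      unfolding L_def by measurable
    fix t :: real
    show "(\<integral>\<^sup>+z. ennreal \<bar>(\<lambda>(t, z). L t z) (t, z)\<bar> \<partial>lborel) \<le> indicator {0<..<1} t * ennreal (C * U)"
    proof (cases "t \<in> {0<..<1}")
      case True
      have "\<bar>L t z\<bar> \<le> C * \<bar>u z\<bar>" for z
      proof -
        have "\<bar>L t z\<bar> = (1 - t) ^ j * (\<bar>u z\<bar> * \<bar>\<psi> (S t z)\<bar>)"
          using True by (simp add: L_def abs_mult)
        also have "\<dots> \<le> 1 * (\<bar>u z\<bar> * C)"
          using True C by (intro mult_mono p1 \<psi>) auto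
        finally show ?thesis by (simp add: mult_ac)
      qed
      then have "(\<integral>\<^sup>+z. ennreal \<bar>L t z\<bar> \<partial>lborel) \<le> (\<integral>\<^sup>+z. ennreal C * ennreal \<bar>u z\<bar> \<partial>lborel)"
        using C by (intro nn_integral_mono) (simp add: ennreal_leI flip: ennreal_mult)
      also have "\<dots> = ennreal C * ennreal U"
        by (simp add: nn_integral_cmult U)
      also have "\<dots> = ennreal (C * U)"
        using C by (simp add: U_def flip: ennreal_mult)
      finally show ?thesis using True by simp
    qed (simp add: L_def)
  qed
  have KL: "(\<integral>z. K t z \<partial>lborel) = (\<integral>z. L t z \<partial>lborel)" for t
  proof (cases "t \<in> {0<..<1}")
    case True
    \<comment> \<open>Writing the argument of \<psi> as \<open>S t (S (inverse t) z)\<close> makes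
      the integrand a function of \<open>S (inverse t) z\<close> alone.\<close>
    have "(\<integral>z. K t z \<partial>lborel) = (1 - t) ^ j / t ^ d * (\<integral>z. u (S (inverse t) z) * \<psi> (S t (S (inverse t) z)) \<partial>lborel)"
      using True by (simp add: K_def dilation_inverse mult_ac flip: integral_mult_right_zero)
    also have "(\<integral>z. u (S (inverse t) z) * \<psi> (S t (S (inverse t) z)) \<partial>lborel) = t ^ d * (\<integral>z. u z * \<psi> (S t z) \<partial>lborel)"
      using True by (intro integral_dilation[of t "\<lambda>z. u z * \<psi> (S t z)"]) auto
    finally show ?thesis using True by (simp add: L_def)
  qed (simp add: K_def L_def)
  have L: "(\<integral>t. L t z \<partial>lborel) = u z * (LINT t:{0<..<1}|lborel. (1 - t) ^ j * \<psi> (S t z))" for z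
    unfolding set_lebesgue_integral_def L_def
    by (simp add: mult_ac flip: integral_mult_right_zero)
  show "integrable lborel (\<lambda>z. u z * (LINT t:{0<..<1}|lborel. (1 - t) ^ j * \<psi> (S t z)))"
    using lborel_pair.integrable_snd[OF intL] by (simp only: L)
  have "(\<integral>z. average j u z * \<psi> z \<partial>lborel) = (\<integral>z. \<integral>t. K t z \<partial>lborel \<partial>lborel)"
    unfolding average_def set_lebesgue_integral_def K_def
    by (simp add: mult.assoc flip: integral_mult_left_zero)
  also have "\<dots> = (\<integral>z. \<integral>t. L t z \<partial>lborel \<partial>lborel)"
    unfolding lborel_pair.Fubini_integral[OF intK] lborel_pair.Fubini_integral[OF intL] KL ..
  finally show "(\<integral>z. average j u z * \<psi> z \<partial>lborel)
      = (\<integral>z. u z * (LINT t:{0<..<1}|lborel. (1 - t) ^ j * \<psi> (S t z)) \<partial>lborel)"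
    by (simp only: L)
qed

text \<open>Jensen's inequality with respect to \<open>(1 - t)\<^sup>j t\<^bsup>d / p - d\<^esup> dt\<close> replaces Minkowski's integral
  inequality: for this weight all dilates of \<open>u\<close> carry the same \<open>L\<^sup>p\<close> norm.\<close>

lemma
  assumes [measurable]: "u \<in> borel_measurable borel" and u: "integrable lborel (\<lambda>z. \<bar>u z\<bar> powr p)"
    and p: "1 \<le> p" "0 < 1 - real d + real d / p"
  shows average_in_Lp_space: "average j u \<in> Lp_space p"
    and Lp_norm_average_le: "Lp_norm p (average j u) \<le> Beta (real j + 1) (1 - real d + real d / p) * Lp_norm p u"
proof -
  define B where "B = Beta (real j + 1) (1 - real d + real d / p)"
  define w where "w t = indicator {0<..<1} t * ((1 - t) ^ j * t powr (1 - real d + real d / p - 1))" for t :: real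
  \<comment> \<open>The factor t^(-d) is split as t^(d/p - d) times t^(-d/p): the first part belongs
    to w, the second normalises the dilate of u in L^p.\<close>
  define h where "h z t = indicator {0<..<1} t * (t powr (- real d / p) * u (S (inverse t) z))" for z t
  define I where "I = (\<integral>z. \<bar>u z\<bar> powr p \<partial>lborel)"
  have [measurable]: "w \<in> borel_measurable borel" unfolding w_def by measurable
  have hm[measurable]: "(\<lambda>(t, z). h z t) \<in> borel_measurable (borel \<Otimes>\<^sub>M borel)" unfolding h_def by measurable
  have w: "integrable lborel w" "\<And>t. 0 \<le> w t" and B: "B = (\<integral>t. w t \<partial>lborel)"
    using integrable_Beta_Ioo[OF p(2), of j] integral_Beta_Ioo[OF p(2), of j]
    by (auto simp: w_def[abs_def] B_def indicator_def)
  have Bpos: "B > 0" unfolding B_def using p by (auto simp: Beta_def intro!: divide_pos_pos mult_pos_pos Gamma_real_pos)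
  have I: "I \<ge> 0" by (simp add: I_def)
  have nnI: "(\<integral>\<^sup>+z. ennreal (\<bar>u z\<bar> powr p) \<partial>lborel) = ennreal I"
    unfolding I_def using u by (intro nn_integral_eq_integral) auto
  have avg: "average j u z = (\<integral>t. w t * h z t \<partial>lborel)" for z
    unfolding average_def set_lebesgue_integral_def
  proof (rule Bochner_Integration.integral_cong[OF refl])
    fix t :: real
    show "indicator {0<..<1} t *\<^sub>R ((1 - t) ^ j * u (S (inverse t) z) / t ^ d) = w t * h z t"
    proof (cases "t \<in> {0<..<1}")
      case True
      have "t powr (1 - real d + real d / p - 1) * t powr (- real d / p) = t powr (- real d)"
        by (simp flip: powr_add)
      also have "\<dots> = inverse (t ^ d)"
        using True by (simp add: powr_minus powr_realpow)
      finally have "t powr (1 - real d + real d / p - 1) * t powr (- real d / p) = inverse (t ^ d)" .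
      with True show ?thesis
        by (simp add: w_def h_def divide_inverse mult_ac)
    qed (simp add: w_def)
  qed
  have slice: "(\<integral>\<^sup>+z. ennreal (w t * \<bar>h z t\<bar> powr p) \<partial>lborel) = ennreal (w t) * ennreal I" for t
  proof (cases "t \<in> {0<..<1}")
    case True
    have "\<bar>h z t\<bar> powr p = inverse (t ^ d) * \<bar>u (S (inverse t) z)\<bar> powr p" for z
    proof -
      have "(t powr (- real d / p)) powr p = t powr (- real d)"
        using p(1) by (simp add: powr_powr)
      also have "\<dots> = inverse (t ^ d)"
        using True by (simp add: powr_minus powr_realpow)
      finally have "(t powr (- real d / p)) powr p = inverse (t ^ d)" .
      moreover have "\<bar>h z t\<bar> powr p = (t powr (- real d / p)) powr p * \<bar>u (S (inverse t) z)\<bar> powr p"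
        using True by (simp add: h_def abs_mult powr_mult)
      ultimately show ?thesis by (simp only:)
    qed
    then have "(\<integral>\<^sup>+z. ennreal (w t * \<bar>h z t\<bar> powr p) \<partial>lborel)
        = (\<integral>\<^sup>+z. ennreal (w t * inverse (t ^ d)) * ennreal (\<bar>u (S (inverse t) z)\<bar> powr p) \<partial>lborel)"
      using True w(2)[of t] by (simp add: ennreal_mult' mult.assoc)
    also have "\<dots> = ennreal (w t * inverse (t ^ d)) * (ennreal (t ^ d) * ennreal I)"
      using True nn_integral_dilation[of t "\<lambda>z. ennreal (\<bar>u z\<bar> powr p)"] by (simp add: nn_integral_cmult nnI)
    also have "\<dots> = ennreal (w t) * ennreal I"
      using True w(2)[of t] I by (simp flip: ennreal_mult)
    finally show ?thesis .
  qed (simp add: w_def)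
  have bound: "(\<integral>\<^sup>+z. ennreal (\<bar>average j u z\<bar> powr p) \<partial>lborel) \<le> ennreal (B powr p * I)"
  proof -
    have "(\<integral>\<^sup>+z. ennreal (\<bar>average j u z\<bar> powr p) \<partial>lborel)
        \<le> (\<integral>\<^sup>+z. ennreal (B powr (p - 1)) * (\<integral>\<^sup>+t. ennreal (w t * \<bar>h z t\<bar> powr p) \<partial>lborel) \<partial>lborel)"
      unfolding avg
      by (rule nn_integral_mono, rule weighted_jensen_powr_nn_integral[OF w B Bpos _ p(1)]) measurable
    also have "\<dots> = ennreal (B powr (p - 1)) * (\<integral>\<^sup>+z. (\<integral>\<^sup>+t. ennreal (w t * \<bar>h z t\<bar> powr p) \<partial>lborel) \<partial>lborel)"
      by (rule nn_integral_cmult) measurable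
    \<comment> \<open>The order is reversed because the z-integral is known exactly from
      \<open>slice\<close>.\<close>
    also have "(\<integral>\<^sup>+z. (\<integral>\<^sup>+t. ennreal (w t * \<bar>h z t\<bar> powr p) \<partial>lborel) \<partial>lborel)
        = (\<integral>\<^sup>+t. (\<integral>\<^sup>+z. ennreal (w t * \<bar>h z t\<bar> powr p) \<partial>lborel) \<partial>lborel)"
      by (rule lborel_pair.Fubini') measurable
    also have "\<dots> = ennreal (B * I)"
      unfolding slice using w I Bpos
      by (simp add: nn_integral_multc nn_integral_eq_integral B[symmetric] flip: ennreal_mult)
    also have "ennreal (B powr (p - 1)) * ennreal (B * I) = ennreal (B powr p * I)"
      using Bpos I by (simp add: powr_diff flip: ennreal_mult)
    finally show ?thesis .
  qed
  have int: "integrable lborel (\<lambda>z. \<bar>average j u z\<bar> powr p)"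
    by (rule integrableI_nonneg) (use le_less_trans[OF bound] in auto)
  then show "average j u \<in> Lp_space p" by (simp add: Lp_space_def)
  have "(\<integral>z. \<bar>average j u z\<bar> powr p \<partial>lborel) \<le> B powr p * I"
    using bound int I by (simp add: nn_integral_eq_integral)
  then have "Lp_norm p (average j u) \<le> (B powr p * I) powr (1 / p)"
    unfolding Lp_norm_def using p(1) by (intro powr_mono2) auto
  also have "\<dots> = B * Lp_norm p u"
    using Bpos I p(1) by (simp add: powr_mult powr_powr Lp_norm_def I_def)
  finally show "Lp_norm p (average j u) \<le> Beta (real j + 1) (1 - real d + real d / p) * Lp_norm p u"
    by (simp add: B_def)
qed

end

interpretation dilation_scaleR: dilation "(*\<^sub>R) :: real \<Rightarrow> 'a \<Rightarrow> 'a::euclidean_space" "DIM('a)"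
proof
  show "(\<lambda>(t, z :: 'a). t *\<^sub>R z) \<in> borel_measurable (borel \<Otimes>\<^sub>M borel)" by measurable
  fix t :: real and z :: 'a and H :: "'a \<Rightarrow> ennreal"
  assume t: "t > 0"
  then show "t *\<^sub>R inverse t *\<^sub>R z = z" by simp
  assume [measurable]: "H \<in> borel_measurable borel"
  have "(\<integral>\<^sup>+z. H z \<partial>lborel) = ennreal (inverse t ^ DIM('a)) * (\<integral>\<^sup>+z. H (inverse t *\<^sub>R z) \<partial>lborel)"
    using t by (subst lborel_affine[of "inverse t" "0 :: 'a"])
      (simp_all add: nn_integral_density nn_integral_distr nn_integral_cmult)
  then show "(\<integral>\<^sup>+z. H (inverse t *\<^sub>R z) \<partial>lborel) = ennreal (t ^ DIM('a)) * (\<integral>\<^sup>+z. H z \<partial>lborel)"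
    using t by (simp add: power_inverse flip: mult.assoc ennreal_mult')
qed

text \<open>For each fixed x this is the dilation of the second factor, so Tonelli reduces the
  change of variables to \<open>dilation_scaleR\<close>.\<close>

interpretation dilation_snd: dilation "\<lambda>t z. (fst z, t *\<^sub>R snd z) :: 'a::euclidean_space \<times> 'b::euclidean_space" "DIM('b)"
proof
  show "(\<lambda>(t, z). (fst z, t *\<^sub>R snd z) :: 'a \<times> 'b) \<in> borel_measurable (borel \<Otimes>\<^sub>M borel)"
    unfolding borel_prod case_prod_unfold by (intro borel_measurable_continuous_onI continuous_intros)
  fix t :: real and z :: "'a \<times> 'b" and H :: "'a \<times> 'b \<Rightarrow> ennreal"
  assume t: "t > 0"
  then show "(fst (fst z, inverse t *\<^sub>R snd z), t *\<^sub>R snd (fst z, inverse t *\<^sub>R snd z)) = z" by simp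
  assume [measurable]: "H \<in> borel_measurable borel"
  have m: "(\<lambda>(x, y). H (x, y)) \<in> borel_measurable (lborel \<Otimes>\<^sub>M lborel)"
    "(\<lambda>(x, y). H (x, inverse t *\<^sub>R y)) \<in> borel_measurable (lborel \<Otimes>\<^sub>M lborel)" by measurable
  have "(\<integral>\<^sup>+z. H (fst z, inverse t *\<^sub>R snd z) \<partial>lborel) = (\<integral>\<^sup>+x. \<integral>\<^sup>+y. H (x, inverse t *\<^sub>R y) \<partial>lborel \<partial>lborel)"
    using lborel.nn_integral_fst[OF m(2)] by (simp add: lborel_prod case_prod_unfold)
  also have "\<dots> = (\<integral>\<^sup>+x. ennreal (t ^ DIM('b)) * (\<integral>\<^sup>+y. H (x, y) \<partial>lborel) \<partial>lborel)"
    using t by (intro nn_integral_cong dilation_scaleR.nn_integral_dilation) measurable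
  also have "\<dots> = ennreal (t ^ DIM('b)) * (\<integral>\<^sup>+x. \<integral>\<^sup>+y. H (x, y) \<partial>lborel \<partial>lborel)"
    by (rule nn_integral_cmult) measurable
  also have "\<dots> = ennreal (t ^ DIM('b)) * (\<integral>\<^sup>+z. H z \<partial>lborel)"
    using lborel.nn_integral_fst[OF m(1)] by (simp add: lborel_prod)
  finally show "(\<integral>\<^sup>+z. H (fst z, inverse t *\<^sub>R snd z) \<partial>lborel) = ennreal (t ^ DIM('b)) * (\<integral>\<^sup>+z. H z \<partial>lborel)" .
qed

section \<open>The expansion of a test function\<close>

lemma test_functionsD:
  assumes "f \<in> test_functions"
  shows "smooth f" "bdd_supp f"
  using assms bdd_supp_continuous smooth_continuous by (auto simp: test_functions_def smooth_def)

lemma dir_deriv_eq_0_outside: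
  assumes K: "closed K" and \<phi>: "\<And>x. x \<notin> K \<Longrightarrow> \<phi> x = 0" and x: "x \<notin> K"
  shows "dir_deriv v \<phi> x = 0"
proof -
  have "(\<phi> has_derivative (\<lambda>_. 0)) (at x)"
    by (rule has_derivative_transform_within_open[of "\<lambda>_. 0" _ _ UNIV "- K"])
       (use K \<phi> x in \<open>auto simp: open_Compl\<close>)
  from frechet_derivative_at[OF this] have "frechet_derivative \<phi> (at x) = (\<lambda>_. 0)" by (rule sym)
  then show ?thesis by (simp add: dir_deriv_def)
qed

text \<open>The closed set K stays fixed while the function is differentiated repeatedly, which
  keeps the inductions free of changing supports.\<close>

lemma mderiv_eq_0_outside:
  assumes K: "closed K" and \<phi>: "\<And>x. x \<notin> K \<Longrightarrow> \<phi> x = 0" and x: "x \<notin> K"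
  shows "mderiv e \<alpha> \<phi> x = 0"
proof -
  have pow: "(dir_deriv v ^^ n) \<psi> x = 0" if "\<And>x. x \<notin> K \<Longrightarrow> \<psi> x = 0" "x \<notin> K" for v n \<psi> x
    using that(2) by (induction n arbitrary: x) (simp_all add: that(1) dir_deriv_eq_0_outside[OF K])
  have "foldr (\<lambda>i. dir_deriv (e i) ^^ \<alpha> i) js \<phi> x = 0" if "x \<notin> K" for js x
    using that by (induction js arbitrary: x) (simp_all add: \<phi> pow)
  then show ?thesis unfolding mderiv_def using x by blast
qed

text \<open>Together with \<open>test_function_bounded\<close> this supplies the bound that
  \<open>integral_average_mult\<close> asks of \<psi>.\<close>

lemma mderiv_test_function:
  assumes \<phi>: "\<phi> \<in> test_functions" and e: "\<And>i. e i \<in> Basis"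
  shows "mderiv e \<alpha> \<phi> \<in> test_functions"
proof -
  define K where "K = closure {x. \<phi> x \<noteq> 0}"
  have K: "compact K" using \<phi> by (simp add: K_def test_functions_def)
  have "\<phi> x = 0" if "x \<notin> K" for x
    using that closure_subset[of "{x. \<phi> x \<noteq> 0}"] by (auto simp: K_def)
  then have "{x. mderiv e \<alpha> \<phi> x \<noteq> 0} \<subseteq> K"
    using mderiv_eq_0_outside[OF compact_imp_closed[OF K]] by blast
  then have "compact (closure {x. mderiv e \<alpha> \<phi> x \<noteq> 0})"
    using K by (metis bounded_subset compact_closure compact_imp_bounded)
  then show ?thesis
    using smooth_mderiv[OF test_functionsD(1)[OF \<phi>] e] by (simp add: test_functions_def smooth_def)
qed

lemma test_function_bounded:
  assumes "\<phi> \<in> test_functions"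
  obtains C where "\<And>z. \<bar>\<phi> z\<bar> \<le> C"
  using bdd_suppE[OF test_functionsD(2)[OF assms]] by metis

section \<open>Coordinate frames, monomials and moments\<close>

lemma frame_in_Basis: "frame i \<in> Basis" "frame_x i \<in> Basis" "frame_y j \<in> Basis"
  by (auto simp: frame_def frame_x_def frame_y_def Basis_prod_def axis_in_Basis_iff)

lemma sum_frame_x: "(\<Sum>i\<in>UNIV. x $ i *\<^sub>R frame_x i) = (x, 0)"
  using basis_expansion[of x] by (simp add: frame_x_def sum_prod scalar_mult_eq_scaleR)

lemma sum_frame_y: "(\<Sum>i\<in>UNIV. y $ i *\<^sub>R frame_y i) = (0, y)"
  using basis_expansion[of y] by (simp add: frame_y_def sum_prod scalar_mult_eq_scaleR)

lemma bounded_linear_axes: "bounded_linear (\<lambda>x. (x, 0))" "bounded_linear (\<lambda>y. (0, y))"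
  by (intro bounded_linear_Pair bounded_linear_ident bounded_linear_zero)+

lemma mderiv_frame_x:
  assumes "smooth \<phi>"
  shows "mderiv frame \<beta> (\<lambda>x. c * \<phi> (x, 0)) = (\<lambda>x. c * mderiv frame_x \<beta> \<phi> (x, 0))"
  using mderiv_affine[OF assms bounded_linear_axes(1), of frame \<beta> c "(0, 0)"]
  by (simp add: frame_in_Basis frame_def frame_x_def[abs_def] Basis_prod_def axis_in_Basis_iff)

lemma mderiv_frame_y:
  assumes "smooth \<phi>"
  shows "mderiv frame \<gamma> (\<lambda>y. \<phi> (x, y)) 0 = mderiv frame_y \<gamma> \<phi> (x, 0)"
  using mderiv_affine[OF assms bounded_linear_axes(2), of frame \<gamma> 1 "(x, 0)"]
  by (simp add: frame_in_Basis frame_def frame_y_def[abs_def] Basis_prod_def axis_in_Basis_iff)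

lemma continuous_on_mpow [continuous_intros]:
  "continuous_on S g \<Longrightarrow> continuous_on S (\<lambda>x. mpow (g x) \<alpha>)"
  unfolding mpow_def by (intro continuous_intros)

lemma abs_mpow_le: "\<bar>mpow x \<alpha>\<bar> \<le> norm x ^ mdeg \<alpha>"
proof -
  have "\<bar>mpow x \<alpha>\<bar> = (\<Prod>i\<in>UNIV. \<bar>x $ i\<bar> ^ \<alpha> i)" by (simp add: mpow_def abs_prod power_abs)
  also have "\<dots> \<le> (\<Prod>i\<in>UNIV. norm x ^ \<alpha> i)"
    by (intro prod_mono conjI power_mono component_le_norm_cart) auto
  also have "\<dots> = norm x ^ mdeg \<alpha>" by (simp add: mdeg_def power_sum)
  finally show ?thesis .
qed

text \<open>The inner integral of \<open>R_op\<close>. It takes the place of f once the expansion in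
  y has been made.\<close>

definition y_moment :: "((real ^ 'm::finite) \<times> (real ^ 'n::finite) \<Rightarrow> real) \<Rightarrow> ('n \<Rightarrow> nat) \<Rightarrow> real ^ 'm \<Rightarrow> real" where
  "y_moment f \<gamma> x = (\<integral>y. f (x, y) * mpow y \<gamma> \<partial>lborel)"

lemma bdd_supp_mult_mpow_y: "bdd_supp f \<Longrightarrow> bdd_supp (\<lambda>z. mpow (snd z) \<gamma> * f z)"
  by (intro bdd_supp_mult_continuous continuous_intros)

lemma bdd_supp_y_moment: "bdd_supp f \<Longrightarrow> bdd_supp (y_moment f \<gamma>)"
  using bdd_supp_integral[OF bdd_supp_mult_mpow_y] by (simp add: y_moment_def[abs_def] mult.commute)

text \<open>The monomial is dilated together with f, so the integrand is a dilate of the single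
  function y^\<gamma> f. The same holds for x^\<beta> times the moment in
  \<open>R_op\<close>.\<close>

lemma F_rem_eq_average:
  "F_rem f k \<gamma> = (\<lambda>z. (real k + 1) * (-1) ^ (k + 1) / mfact \<gamma> *
     dilation_snd.average k (\<lambda>z. mpow (snd z) \<gamma> * f z) z)"
  unfolding F_rem_def dilation_snd.average_def by (auto simp: mult.assoc)

lemma R_op_eq_average:
  "R_op f \<beta> \<gamma> = (\<lambda>x. (-1) ^ mdeg \<beta> * real (mdeg \<beta>) / mfact \<beta> *
     dilation_scaleR.average (mdeg \<beta> - 1) (\<lambda>x. mpow x \<beta> * y_moment f \<gamma> x) x)"
  unfolding R_op_def dilation_scaleR.average_def y_moment_def by (auto simp: mult.assoc)

text \<open>The order of the expansion in x depends on |\<gamma>|, so the moments appear as an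
  iterated sum before they appear as a sum over pairs.\<close>

lemma sum_mdeg_pair:
  fixes h :: "('m::finite \<Rightarrow> nat) \<Rightarrow> ('n::finite \<Rightarrow> nat) \<Rightarrow> real"
  shows "(\<Sum>(\<beta>, \<gamma>) | mdeg \<beta> + mdeg \<gamma> \<le> k. h \<beta> \<gamma>) = (\<Sum>\<gamma> | mdeg \<gamma> \<le> k. \<Sum>\<beta> | mdeg \<beta> \<le> k - mdeg \<gamma>. h \<beta> \<gamma>)"
proof -
  have "(\<Sum>\<gamma> | mdeg \<gamma> \<le> k. \<Sum>\<beta> | mdeg \<beta> \<le> k - mdeg \<gamma>. h \<beta> \<gamma>)
      = (\<Sum>(\<gamma>, \<beta>)\<in>(SIGMA \<gamma>:{\<gamma>. mdeg \<gamma> \<le> k}. {\<beta>. mdeg \<beta> \<le> k - mdeg \<gamma>}). h \<beta> \<gamma>)"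
    by (rule sum.Sigma) (auto simp: finite_mdeg_le)
  also have "\<dots> = (\<Sum>(\<beta>, \<gamma>) | mdeg \<beta> + mdeg \<gamma> \<le> k. h \<beta> \<gamma>)"
    by (rule sum.reindex_bij_witness[of _ prod.swap prod.swap]) auto
  finally show ?thesis by simp
qed

text \<open>In the polynomial part the derivatives at (x, 0) are constant in y, so Fubini leaves
  only moments of f in y.\<close>

lemma integral_y_expansion:
  fixes f \<phi> :: "(real ^ 'm::finite) \<times> (real ^ 'n::finite) \<Rightarrow> real"
  assumes f: "bdd_supp f" and \<phi>: "\<phi> \<in> test_functions"
  shows "(\<integral>z. f z * \<phi> z \<partial>lborel)
    = (\<Sum>\<gamma> | mdeg \<gamma> \<le> k. (\<integral>x. y_moment f \<gamma> x * mderiv frame_y \<gamma> \<phi> (x, 0) \<partial>lborel) / mfact \<gamma>)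
    + (\<Sum>\<gamma> | mdeg \<gamma> = Suc k. real (Suc k) / mfact \<gamma> *
        (\<integral>z. dilation_snd.average k (\<lambda>z. mpow (snd z) \<gamma> * f z) z * mderiv frame_y \<gamma> \<phi> z \<partial>lborel))"
proof -
  let ?D = "\<lambda>\<gamma>. mderiv frame_y \<gamma> \<phi>"
  let ?u = "\<lambda>\<gamma> z. mpow (snd z) \<gamma> * f z"
  let ?I = "\<lambda>\<gamma> z. LINT t:{0<..<1}|lborel. (1 - t) ^ k * ?D \<gamma> (fst z, t *\<^sub>R snd z)"
  have D: "smooth (?D \<gamma>)" for \<gamma> by (intro smooth_mderiv test_functionsD[OF \<phi>] frame_in_Basis)
  have Dm[measurable]: "?D \<gamma> \<in> borel_measurable borel" for \<gamma>
    by (intro borel_measurable_continuous_onI smooth_continuous D)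
  have u: "bdd_supp (?u \<gamma>)" for \<gamma> by (intro bdd_supp_mult_mpow_y f)
  have taylor: "\<phi> z = (\<Sum>\<gamma> | mdeg \<gamma> \<le> k. mpow (snd z) \<gamma> / mfact \<gamma> * ?D \<gamma> (fst z, 0))
     + (\<Sum>\<gamma> | mdeg \<gamma> = Suc k. real (Suc k) / mfact \<gamma> * (mpow (snd z) \<gamma> * ?I \<gamma> z))" for z
    using taylor_mderiv[OF test_functionsD(1)[OF \<phi>] frame_in_Basis(3) sum_frame_y[symmetric],
        of "(fst z, 0)" "snd z" k] by simp
  \<comment> \<open>The derivative at (x, 0), as a function of (x, y), is constant in y and has no
    bounded support unless it vanishes. The factor f restores bounded support.\<close>
  have int1: "bdd_supp (\<lambda>z. ?D \<gamma> (fst z, 0) * ?u \<gamma> z)" for \<gamma>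
    by (intro bdd_supp_mult_continuous u continuous_on_compose2[OF smooth_continuous[OF D, of UNIV]])
       (auto intro!: continuous_intros)
  have avg: "integrable lborel (\<lambda>z. ?u \<gamma> z * ?I \<gamma> z)"
      "(\<integral>z. ?u \<gamma> z * ?I \<gamma> z \<partial>lborel) = (\<integral>z. dilation_snd.average k (?u \<gamma>) z * ?D \<gamma> z \<partial>lborel)" for \<gamma>
  proof -
    have "?D \<gamma> \<in> test_functions"
      by (intro mderiv_test_function \<phi> frame_in_Basis)
    then obtain C where C: "\<And>z. \<bar>?D \<gamma> z\<bar> \<le> C" using test_function_bounded by blast
    show "integrable lborel (\<lambda>z. ?u \<gamma> z * ?I \<gamma> z)"
      by (rule dilation_snd.integrable_mult_average[OF bdd_supp_integrable[OF u] Dm C])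
    show "(\<integral>z. ?u \<gamma> z * ?I \<gamma> z \<partial>lborel) = (\<integral>z. dilation_snd.average k (?u \<gamma>) z * ?D \<gamma> z \<partial>lborel)"
      by (rule dilation_snd.integral_average_mult[OF bdd_supp_integrable[OF u] Dm C, symmetric])
  qed
  have fubini: "(\<integral>z. ?D \<gamma> (fst z, 0) * ?u \<gamma> z \<partial>lborel) = (\<integral>x. y_moment f \<gamma> x * ?D \<gamma> (x, 0) \<partial>lborel)" for \<gamma>
  proof -
    have "integrable (lborel \<Otimes>\<^sub>M lborel) (\<lambda>z. ?D \<gamma> (fst z, 0) * ?u \<gamma> z)"
      using bdd_supp_integrable[OF int1] by (simp add: lborel_prod)
    from lborel_pair.integral_fst'[OF this]
    have "(\<integral>z. ?D \<gamma> (fst z, 0) * ?u \<gamma> z \<partial>lborel) = (\<integral>x. ?D \<gamma> (x, 0) * (\<integral>y. mpow y \<gamma> * f (x, y) \<partial>lborel) \<partial>lborel)"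
      by (simp add: lborel_prod)
    then show ?thesis by (simp add: y_moment_def mult.commute)
  qed
  have "(\<integral>z. f z * \<phi> z \<partial>lborel) =
    (\<integral>z. (\<Sum>\<gamma> | mdeg \<gamma> \<le> k. (?D \<gamma> (fst z, 0) * ?u \<gamma> z) / mfact \<gamma>)
     + (\<Sum>\<gamma> | mdeg \<gamma> = Suc k. real (Suc k) / mfact \<gamma> * (?u \<gamma> z * ?I \<gamma> z)) \<partial>lborel)"
    by (subst taylor) (simp add: distrib_left sum_distrib_left mult_ac)
  also have "\<dots> = (\<Sum>\<gamma> | mdeg \<gamma> \<le> k. (\<integral>z. ?D \<gamma> (fst z, 0) * ?u \<gamma> z \<partial>lborel) / mfact \<gamma>)
     + (\<Sum>\<gamma> | mdeg \<gamma> = Suc k. real (Suc k) / mfact \<gamma> * (\<integral>z. ?u \<gamma> z * ?I \<gamma> z \<partial>lborel))"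
  proof -
    have "integrable lborel (\<lambda>z. (?D \<gamma> (fst z, 0) * ?u \<gamma> z) / mfact \<gamma>)" for \<gamma>
      by (intro integrable_divide bdd_supp_integrable int1)
    moreover have "integrable lborel (\<lambda>z. real (Suc k) / mfact \<gamma> * (?u \<gamma> z * ?I \<gamma> z))" for \<gamma>
      by (intro Bochner_Integration.integrable_mult_right avg)
    ultimately show ?thesis
      by (subst Bochner_Integration.integral_add)
         (auto simp: Bochner_Integration.integral_sum simp del: of_nat_Suc)
  qed
  finally show ?thesis by (simp only: fubini avg)
qed

text \<open>Here \<open>y_moment f \<gamma>\<close> plays the part of f. The number k is the order
  of the expansion in x alone, and k - |\<gamma>| is substituted for it in the final
  identity.\<close>

lemma integral_x_expansion:
  fixes f \<phi> :: "(real ^ 'm::finite) \<times> (real ^ 'n::finite) \<Rightarrow> real"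
  assumes f: "bdd_supp f" and \<phi>: "\<phi> \<in> test_functions"
  defines "D \<equiv> \<lambda>\<beta> \<gamma>. mderiv frame_x \<beta> (mderiv frame_y \<gamma> \<phi>)"
  shows "(\<integral>x. y_moment f \<gamma> x * mderiv frame_y \<gamma> \<phi> (x, 0) \<partial>lborel)
    = (\<Sum>\<beta> | mdeg \<beta> \<le> k. (\<integral>z. f z * mpow (fst z) \<beta> * mpow (snd z) \<gamma> \<partial>lborel) * D \<beta> \<gamma> 0 / mfact \<beta>)
    + (\<Sum>\<beta> | mdeg \<beta> = Suc k. real (Suc k) / mfact \<beta> *
        (\<integral>x. dilation_scaleR.average k (\<lambda>x. mpow x \<beta> * y_moment f \<gamma> x) x * D \<beta> \<gamma> (x, 0) \<partial>lborel))"
proof -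
  let ?u = "\<lambda>\<beta> x. mpow x \<beta> * y_moment f \<gamma> x"
  let ?I = "\<lambda>\<beta> x. LINT t:{0<..<1}|lborel. (1 - t) ^ k * D \<beta> \<gamma> (t *\<^sub>R x, 0)"
  have D: "smooth (D \<beta> \<gamma>)" for \<beta>
    unfolding D_def by (intro smooth_mderiv test_functionsD[OF \<phi>] frame_in_Basis)
  have Dm: "(\<lambda>x. D \<beta> \<gamma> (x, 0)) \<in> borel_measurable borel" for \<beta>
    by (intro borel_measurable_continuous_onI continuous_on_compose2[OF smooth_continuous[OF D, of UNIV]])
       (auto intro!: continuous_intros)
  have u: "bdd_supp (?u \<beta>)" for \<beta>
    by (intro bdd_supp_mult_continuous bdd_supp_y_moment f continuous_intros)
  have taylor: "mderiv frame_y \<gamma> \<phi> (x, 0) = (\<Sum>\<beta> | mdeg \<beta> \<le> k. mpow x \<beta> / mfact \<beta> * D \<beta> \<gamma> 0)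
     + (\<Sum>\<beta> | mdeg \<beta> = Suc k. real (Suc k) / mfact \<beta> * (mpow x \<beta> * ?I \<beta> x))" for x
    using taylor_mderiv[OF smooth_mderiv[OF test_functionsD(1)[OF \<phi>] frame_in_Basis(3)] frame_in_Basis(2)
        sum_frame_x[symmetric], where k=k and a=0 and y=x] by (simp add: D_def)
  have avg: "integrable lborel (\<lambda>x. ?u \<beta> x * ?I \<beta> x)"
      "(\<integral>x. ?u \<beta> x * ?I \<beta> x \<partial>lborel) = (\<integral>x. dilation_scaleR.average k (?u \<beta>) x * D \<beta> \<gamma> (x, 0) \<partial>lborel)" for \<beta>
  proof -
    have "D \<beta> \<gamma> \<in> test_functions"
      unfolding D_def by (intro mderiv_test_function \<phi> frame_in_Basis)
    then obtain C where C: "\<And>z. \<bar>D \<beta> \<gamma> z\<bar> \<le> C" using test_function_bounded by blast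
    show "integrable lborel (\<lambda>x. ?u \<beta> x * ?I \<beta> x)"
      by (rule dilation_scaleR.integrable_mult_average[OF bdd_supp_integrable[OF u] Dm C])
    show "(\<integral>x. ?u \<beta> x * ?I \<beta> x \<partial>lborel) = (\<integral>x. dilation_scaleR.average k (?u \<beta>) x * D \<beta> \<gamma> (x, 0) \<partial>lborel)"
      by (rule dilation_scaleR.integral_average_mult[OF bdd_supp_integrable[OF u] Dm C, symmetric])
  qed
  have fubini: "(\<integral>x. ?u \<beta> x \<partial>lborel) = (\<integral>z. f z * mpow (fst z) \<beta> * mpow (snd z) \<gamma> \<partial>lborel)" for \<beta>
  proof -
    have "bdd_supp (\<lambda>z. (mpow (fst z) \<beta> * mpow (snd z) \<gamma>) * f z)"
      by (intro bdd_supp_mult_continuous f continuous_intros)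
    then have "integrable (lborel \<Otimes>\<^sub>M lborel) (\<lambda>z. (mpow (fst z) \<beta> * mpow (snd z) \<gamma>) * f z)"
      by (simp add: bdd_supp_integrable lborel_prod)
    from lborel_pair.integral_fst'[OF this]
    show ?thesis by (simp add: lborel_prod y_moment_def mult_ac)
  qed
  have "(\<integral>x. y_moment f \<gamma> x * mderiv frame_y \<gamma> \<phi> (x, 0) \<partial>lborel) =
    (\<integral>x. (\<Sum>\<beta> | mdeg \<beta> \<le> k. ?u \<beta> x * (D \<beta> \<gamma> 0 / mfact \<beta>))
     + (\<Sum>\<beta> | mdeg \<beta> = Suc k. real (Suc k) / mfact \<beta> * (?u \<beta> x * ?I \<beta> x)) \<partial>lborel)"
    by (subst taylor) (simp add: distrib_left sum_distrib_left mult_ac)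
  also have "\<dots> = (\<Sum>\<beta> | mdeg \<beta> \<le> k. (\<integral>x. ?u \<beta> x \<partial>lborel) * (D \<beta> \<gamma> 0 / mfact \<beta>))
     + (\<Sum>\<beta> | mdeg \<beta> = Suc k. real (Suc k) / mfact \<beta> * (\<integral>x. ?u \<beta> x * ?I \<beta> x \<partial>lborel))"
  proof -
    have "integrable lborel (\<lambda>x. ?u \<beta> x * (D \<beta> \<gamma> 0 / mfact \<beta>))" for \<beta>
      by (intro Bochner_Integration.integrable_mult_left bdd_supp_integrable u)
    moreover have "integrable lborel (\<lambda>x. real (Suc k) / mfact \<beta> * (?u \<beta> x * ?I \<beta> x))" for \<beta>
      by (intro Bochner_Integration.integrable_mult_right avg)
    ultimately show ?thesis
      by (subst Bochner_Integration.integral_add)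
         (auto simp: Bochner_Integration.integral_sum simp del: of_nat_Suc)
  qed
  finally show ?thesis by (simp only: fubini avg times_divide_eq_right)
qed

text \<open>Each sign created by transposing a derivative meets an equal sign in a coefficient.
  After their cancellation the right-hand side is the integral of f \<phi>, expanded in y and then
  in x.\<close>

lemma distribution_identity:
  fixes f \<phi> :: "(real ^ 'm::finite) \<times> (real ^ 'n::finite) \<Rightarrow> real"
  assumes f: "f \<in> test_functions" and \<phi>: "\<phi> \<in> test_functions"
  shows "distr_of f \<phi> =
          (\<Sum>(\<beta>, \<gamma>) | mdeg \<beta> + mdeg \<gamma> \<le> k.
             (-1) ^ (mdeg \<beta> + mdeg \<gamma>) / (mfact \<beta> * mfact \<gamma>) *
             (\<integral>(x, y). f (x, y) * mpow x \<beta> * mpow y \<gamma> \<partial>lborel) *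
             distr_deriv frame_x \<beta> (distr_deriv frame_y \<gamma> dirac0) \<phi>)
        + (\<Sum>\<gamma> | mdeg \<gamma> \<le> k. \<Sum>\<beta> | mdeg \<beta> = k + 1 - mdeg \<gamma>.
             (-1) ^ mdeg \<gamma> / mfact \<gamma> *
             distr_tensor (distr_deriv frame \<beta> (distr_of (R_op f \<beta> \<gamma>)))
                          (distr_deriv frame \<gamma> dirac0) \<phi>)
        + (\<Sum>\<gamma> | mdeg \<gamma> = k + 1. distr_deriv frame_y \<gamma> (distr_of (F_rem f k \<gamma>)) \<phi>)"
    (is "_ = ?moments + ?R + ?F")
proof -
  have fb: "bdd_supp f" and s: "smooth \<phi>" using test_functionsD f \<phi> by auto
  let ?D = "\<lambda>\<beta> \<gamma>. mderiv frame_x \<beta> (mderiv frame_y \<gamma> \<phi>)"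
  let ?M = "\<lambda>\<beta> \<gamma>. \<integral>z. f z * mpow (fst z) \<beta> * mpow (snd z) \<gamma> \<partial>lborel"
  let ?A = "\<lambda>\<beta> \<gamma>. \<integral>x. dilation_scaleR.average (mdeg \<beta> - 1) (\<lambda>x. mpow x \<beta> * y_moment f \<gamma> x) x * ?D \<beta> \<gamma> (x, 0) \<partial>lborel"
  have D: "smooth (mderiv frame_y \<gamma> \<phi>)" for \<gamma> by (intro smooth_mderiv s frame_in_Basis)
  have sgn: "(-1) ^ a * ((-1) ^ a * x) = (x :: real)" for a x
    by (simp flip: mult.assoc power_mult_distrib)
  have F: "distr_deriv frame_y \<gamma> (distr_of (F_rem f k \<gamma>)) \<phi> = real (Suc k) / mfact \<gamma> *
        (\<integral>z. dilation_snd.average k (\<lambda>z. mpow (snd z) \<gamma> * f z) z * mderiv frame_y \<gamma> \<phi> z \<partial>lborel)"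
    if "mdeg \<gamma> = Suc k" for \<gamma>
  proof -
    have "distr_deriv frame_y \<gamma> (distr_of (F_rem f k \<gamma>)) \<phi>
      = (-1) ^ (k + 1) * (\<integral>z. (-1) ^ (k + 1) * (real (Suc k) / mfact \<gamma> *
        (dilation_snd.average k (\<lambda>z. mpow (snd z) \<gamma> * f z) z * mderiv frame_y \<gamma> \<phi> z)) \<partial>lborel)"
      unfolding distr_deriv_def distr_of_def F_rem_eq_average that by (simp add: mult_ac add.commute)
    then show ?thesis
      unfolding integral_mult_right_zero sgn .
  qed
  \<comment> \<open>The sign from the transposed x-derivative cancels the one inside
    \<open>R_op\<close>, and the sign from the derivative of \<open>dirac0\<close> cancels the one
    in front of the tensor product.\<close>
  have R: "(-1) ^ mdeg \<gamma> / mfact \<gamma> * distr_tensor (distr_deriv frame \<beta> (distr_of (R_op f \<beta> \<gamma>)))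
             (distr_deriv frame \<gamma> dirac0) \<phi> = real (mdeg \<beta>) / mfact \<beta> * ?A \<beta> \<gamma> / mfact \<gamma>" for \<beta> \<gamma>
  proof -
    have "distr_tensor (distr_deriv frame \<beta> (distr_of (R_op f \<beta> \<gamma>))) (distr_deriv frame \<gamma> dirac0) \<phi>
      = (-1) ^ mdeg \<beta> * (\<integral>x. (-1) ^ mdeg \<beta> * ((-1) ^ mdeg \<gamma> * (real (mdeg \<beta>) / mfact \<beta> *
          (dilation_scaleR.average (mdeg \<beta> - 1) (\<lambda>x. mpow x \<beta> * y_moment f \<gamma> x) x * ?D \<beta> \<gamma> (x, 0)))) \<partial>lborel)"
      unfolding distr_tensor_def distr_deriv_def distr_of_def dirac0_def R_op_eq_average
        mderiv_frame_y[OF s] mderiv_frame_x[OF D]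
      by (simp add: mult_ac)
    then have "distr_tensor (distr_deriv frame \<beta> (distr_of (R_op f \<beta> \<gamma>))) (distr_deriv frame \<gamma> dirac0) \<phi>
      = (-1) ^ mdeg \<gamma> * (real (mdeg \<beta>) / mfact \<beta> * ?A \<beta> \<gamma>)"
      unfolding integral_mult_right_zero sgn .
    then show ?thesis using sgn[of "mdeg \<gamma>"] by simp
  qed
  have moments: "(-1) ^ (mdeg \<beta> + mdeg \<gamma>) / (mfact \<beta> * mfact \<gamma>) *
             (\<integral>(x, y). f (x, y) * mpow x \<beta> * mpow y \<gamma> \<partial>lborel) *
             distr_deriv frame_x \<beta> (distr_deriv frame_y \<gamma> dirac0) \<phi>
       = (?M \<beta> \<gamma> * ?D \<beta> \<gamma> 0 / mfact \<beta>) / mfact \<gamma>" for \<beta> \<gamma>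
  proof -
    have "mderiv frame_y \<gamma> (mderiv frame_x \<beta> \<phi>) = ?D \<beta> \<gamma>"
      by (rule mderiv_commute) (auto simp: s frame_in_Basis)
    then have "(-1) ^ (mdeg \<beta> + mdeg \<gamma>) * distr_deriv frame_x \<beta> (distr_deriv frame_y \<gamma> dirac0) \<phi> = ?D \<beta> \<gamma> 0"
      by (simp add: distr_deriv_def dirac0_def power_add mult.assoc mult.left_commute[of "(-1) ^ mdeg \<gamma>"] sgn)
    moreover have "(\<integral>(x, y). f (x, y) * mpow x \<beta> * mpow y \<gamma> \<partial>lborel) = ?M \<beta> \<gamma>"
      by (simp add: case_prod_unfold)
    ultimately show ?thesis by (simp add: mult.commute mult.left_commute)
  qed
  have x: "(\<integral>x. y_moment f \<gamma> x * mderiv frame_y \<gamma> \<phi> (x, 0) \<partial>lborel) / mfact \<gamma>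
      = (\<Sum>\<beta> | mdeg \<beta> \<le> k - mdeg \<gamma>. ?M \<beta> \<gamma> * ?D \<beta> \<gamma> 0 / mfact \<beta> / mfact \<gamma>)
      + (\<Sum>\<beta> | mdeg \<beta> = k + 1 - mdeg \<gamma>. real (mdeg \<beta>) / mfact \<beta> * ?A \<beta> \<gamma> / mfact \<gamma>)"
    if "mdeg \<gamma> \<le> k" for \<gamma>
  proof -
    \<comment> \<open>For |\<gamma>| <= k the truncated subtractions are exact, and |\<beta>| = k +
      1 - |\<gamma>| gives the weight exponent |\<beta>| - 1 = k - |\<gamma>|.\<close>
    have "k + 1 - mdeg \<gamma> = Suc (k - mdeg \<gamma>)" using that by simp
    moreover have "(\<Sum>\<beta> | mdeg \<beta> = Suc (k - mdeg \<gamma>). real (mdeg \<beta>) / mfact \<beta> * ?A \<beta> \<gamma>)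
      = (\<Sum>\<beta> | mdeg \<beta> = Suc (k - mdeg \<gamma>). real (Suc (k - mdeg \<gamma>)) / mfact \<beta> *
        (\<integral>x. dilation_scaleR.average (k - mdeg \<gamma>) (\<lambda>x. mpow x \<beta> * y_moment f \<gamma> x) x * ?D \<beta> \<gamma> (x, 0) \<partial>lborel))"
      by (intro sum.cong) auto
    ultimately show ?thesis
      unfolding integral_x_expansion[OF fb \<phi>, where k = "k - mdeg \<gamma>"] by (simp only: add_divide_distrib sum_divide_distrib[symmetric])
  qed
  have "distr_of f \<phi> = (\<Sum>\<gamma> | mdeg \<gamma> \<le> k. (\<integral>x. y_moment f \<gamma> x * mderiv frame_y \<gamma> \<phi> (x, 0) \<partial>lborel) / mfact \<gamma>) + ?F"
    unfolding distr_of_def[of f] integral_y_expansion[OF fb \<phi>, where k = k] using F by (simp del: of_nat_Suc)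
  also have "(\<Sum>\<gamma> | mdeg \<gamma> \<le> k. (\<integral>x. y_moment f \<gamma> x * mderiv frame_y \<gamma> \<phi> (x, 0) \<partial>lborel) / mfact \<gamma>)
      = (\<Sum>\<gamma> | mdeg \<gamma> \<le> k. (\<Sum>\<beta> | mdeg \<beta> \<le> k - mdeg \<gamma>. ?M \<beta> \<gamma> * ?D \<beta> \<gamma> 0 / mfact \<beta> / mfact \<gamma>)
      + (\<Sum>\<beta> | mdeg \<beta> = k + 1 - mdeg \<gamma>. real (mdeg \<beta>) / mfact \<beta> * ?A \<beta> \<gamma> / mfact \<gamma>))"
    by (intro sum.cong refl x) simp
  also have "\<dots> = ?moments + ?R"
    unfolding sum.distrib sum_mdeg_pair[symmetric] R moments ..
  finally show ?thesis by simp
qed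

section \<open>Norm estimates for the remainders\<close>

lemma Lp_norm_cmult: "1 \<le> p \<Longrightarrow> Lp_norm p (\<lambda>z. c * g z) = \<bar>c\<bar> * Lp_norm p g"
  by (simp add: Lp_norm_def abs_mult powr_mult powr_powr)

lemma Lp_space_cmult: "g \<in> Lp_space p \<Longrightarrow> (\<lambda>z. c * g z) \<in> Lp_space p"
  by (auto simp: Lp_space_def abs_mult powr_mult)

text \<open>The comparison is with a majorant of the p-th power because \<open>mixed_norm\<close> is
  written as the root of an integral of that kind.\<close>

lemma Lp_norm_mono:
  assumes "u \<in> borel_measurable lborel" "integrable lborel h" "\<And>z. \<bar>u z\<bar> powr p \<le> h z" "1 \<le> p"
  shows "Lp_norm p u \<le> (\<integral>z. h z \<partial>lborel) powr (1 / p)"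
proof -
  have "(\<integral>z. \<bar>u z\<bar> powr p \<partial>lborel) \<le> (\<integral>z. h z \<partial>lborel)"
    using assms(3) order_trans[OF powr_ge_zero] by (intro integral_mono'[OF assms(2)]) auto
  then show ?thesis unfolding Lp_norm_def using assms(4) by (intro powr_mono2) auto
qed

lemma Beta_exponent_pos:
  assumes "1 \<le> p" "ereal p < ereal (real d) / ereal (real d - 1)" "d > 0"
  shows "0 < 1 - real d + real d / p"
proof (cases "d = 1")
  case False
  then have d: "real d - 1 > 0" using assms(3) by simp
  then have "p < real d / (real d - 1)" using assms(2) by simp
  then have "real d - 1 < real d / p" using d assms(1) by (simp add: field_simps)
  then show ?thesis by simp
qed (use assms in simp)

text \<open>The averaging estimate is applied to y^\<gamma> f, whose norm is then compared with that
  of |y|^(k+1) f through |y^\<gamma>| <= |y|^|\<gamma>|. The prefactor (k+1)/\<gamma>! times the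
  Beta value is \<open>remainder_const\<close>.\<close>

lemma F_rem_bound:
  fixes f :: "(real ^ 'm::finite) \<times> (real ^ 'n::finite) \<Rightarrow> real"
  assumes f: "f \<in> test_functions"
    and p: "1 \<le> p" "ereal p < ereal (real CARD('n)) / ereal (real CARD('n) - 1)"
    and \<gamma>: "mdeg \<gamma> = k + 1"
  shows "F_rem f k \<gamma> \<in> Lp_space p"
    and "Lp_norm p (F_rem f k \<gamma>)
      \<le> remainder_const p (k + 1) \<gamma> * Lp_norm p (\<lambda>(x, y). norm y ^ (k + 1) * f (x, y))"
proof -
  let ?u = "\<lambda>z. mpow (snd z) \<gamma> * f z"
  let ?v = "\<lambda>z. norm (snd z) ^ (k + 1) * f z"
  let ?e = "1 - real CARD('n) + real CARD('n) / p"
  have fb: "bdd_supp f" using f by (rule test_functionsD)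
  have u: "bdd_supp ?u" and v: "bdd_supp ?v"
    by (intro bdd_supp_mult_continuous fb continuous_intros)+
  have e: "0 < ?e" by (rule Beta_exponent_pos[OF p]) simp
  have 1: "?u \<in> borel_measurable borel" "integrable lborel (\<lambda>z. \<bar>?u z\<bar> powr p)"
    using bdd_supp_measurable[OF u] bdd_supp_integrable[OF bdd_supp_abs_powr[OF u]] p(1) by auto
  note A = dilation_snd.average_in_Lp_space[OF 1 p(1), of k] dilation_snd.Lp_norm_average_le[OF 1 p(1), of k]
  show "F_rem f k \<gamma> \<in> Lp_space p"
    unfolding F_rem_eq_average by (intro Lp_space_cmult A) (use e in simp)
  have "\<bar>?u z\<bar> powr p \<le> \<bar>?v z\<bar> powr p" for z
    using abs_mpow_le[of "snd z" \<gamma>] p(1)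
    by (intro powr_mono2) (auto simp: abs_mult \<gamma> intro!: mult_right_mono)
  moreover have "integrable lborel (\<lambda>z. \<bar>?v z\<bar> powr p)"
    using bdd_supp_integrable[OF bdd_supp_abs_powr[OF v]] p(1) by auto
  ultimately have uv: "Lp_norm p ?u \<le> Lp_norm p ?v"
    unfolding Lp_norm_def[of p ?v] using 1 p(1) by (intro Lp_norm_mono) auto
  have c: "0 \<le> Beta (real k + 1) ?e"
    using e by (auto simp: Beta_def intro!: divide_nonneg_nonneg mult_nonneg_nonneg less_imp_le[OF Gamma_real_pos])
  have A2: "Lp_norm p (dilation_snd.average k ?u) \<le> Beta (real k + 1) ?e * Lp_norm p ?u"
    using A(2) e by simp
  have "Lp_norm p (F_rem f k \<gamma>) = (real k + 1) / mfact \<gamma> * Lp_norm p (dilation_snd.average k ?u)"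
    unfolding F_rem_eq_average Lp_norm_cmult[OF p(1)] using mfact_pos[of \<gamma>] by (simp add: abs_mult)
  also have "\<dots> \<le> (real k + 1) / mfact \<gamma> * (Beta (real k + 1) ?e * Lp_norm p ?v)"
    using order_trans[OF A2 mult_left_mono[OF uv c]] mfact_pos[of \<gamma>] by (intro mult_left_mono) auto
  finally show "Lp_norm p (F_rem f k \<gamma>)
      \<le> remainder_const p (k + 1) \<gamma> * Lp_norm p (\<lambda>(x, y). norm y ^ (k + 1) * f (x, y))"
    by (simp add: remainder_const_def case_prod_unfold add.commute)
qed

text \<open>The averaged function is x^\<beta> times a moment of f, dominated at each x by
  |x|^|\<beta>| times the L^1 norm in y of |y|^|\<gamma>| f(x, y). The p-th power of this majorant
  is the integrand of \<open>mixed_norm\<close>.\<close>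

lemma R_op_bound:
  fixes f :: "(real ^ 'm::finite) \<times> (real ^ 'n::finite) \<Rightarrow> real"
  assumes f: "f \<in> test_functions"
    and p: "1 \<le> p" "ereal p < ereal (real CARD('m)) / ereal (real CARD('m) - 1)"
    and \<beta>: "mdeg \<beta> \<noteq> 0"
  shows "R_op f \<beta> \<gamma> \<in> Lp_space p"
    and "Lp_norm p (R_op f \<beta> \<gamma>)
      \<le> remainder_const p (mdeg \<beta>) \<beta> * mixed_norm p (mdeg \<beta>) (mdeg \<gamma>) f"
proof -
  let ?u = "\<lambda>x. mpow x \<beta> * y_moment f \<gamma> x"
  let ?w = "\<lambda>z. norm (snd z) ^ mdeg \<gamma> * \<bar>f z\<bar>"
  let ?G = "\<lambda>x. \<integral>y. ?w (x, y) \<partial>lborel"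
  let ?h = "\<lambda>x. norm x powr (p * real (mdeg \<beta>)) * ?G x powr p"
  let ?j = "mdeg \<beta> - 1"
  let ?e = "1 - real CARD('m) + real CARD('m) / p"
  have fb: "bdd_supp f" using f by (rule test_functionsD)
  have u: "bdd_supp ?u"
    by (intro bdd_supp_mult_continuous bdd_supp_y_moment fb continuous_intros)
  have w: "bdd_supp ?w"
    by (intro bdd_supp_mult_continuous bdd_supp_abs fb continuous_intros)
  have G0: "0 \<le> ?G x" for x by (intro Bochner_Integration.integral_nonneg) auto
  have e: "0 < ?e" by (rule Beta_exponent_pos[OF p]) simp
  have 1: "?u \<in> borel_measurable borel" "integrable lborel (\<lambda>z. \<bar>?u z\<bar> powr p)"
    using bdd_supp_measurable[OF u] bdd_supp_integrable[OF bdd_supp_abs_powr[OF u]] p(1) by auto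
  note A = dilation_scaleR.average_in_Lp_space[OF 1 p(1), of ?j] dilation_scaleR.Lp_norm_average_le[OF 1 p(1), of ?j]
  show "R_op f \<beta> \<gamma> \<in> Lp_space p"
    unfolding R_op_eq_average by (intro Lp_space_cmult A) (use e in simp)
  have m: "\<bar>y_moment f \<gamma> x\<bar> \<le> ?G x" for x
  proof -
    have "\<bar>y_moment f \<gamma> x\<bar> \<le> (\<integral>y. \<bar>f (x, y) * mpow y \<gamma>\<bar> \<partial>lborel)"
      unfolding y_moment_def by (rule integral_abs_bound)
    also have "\<dots> \<le> ?G x"
      using abs_mpow_le[of _ \<gamma>]
      by (intro integral_mono' bdd_supp_integrable[OF bdd_supp_slice[OF w]])
         (auto simp: abs_mult mult.commute[of "\<bar>f _\<bar>"] intro!: mult_right_mono)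
    finally show ?thesis .
  qed
  have le: "\<bar>?u x\<bar> powr p \<le> ?h x" for x
  \<comment> \<open>Rewriting the power of \<open>norm x\<close> by \<open>powr\<close> requires
    \<open>norm x > 0\<close>. At x = 0 the left-hand side vanishes because |\<beta>| > 0.\<close>
  proof (cases "x = 0")
    case True
    then have "mpow x \<beta> = 0" using abs_mpow_le[of x \<beta>] \<beta> by (simp add: power_0_left)
    then show ?thesis by simp
  next
    case False
    have "\<bar>?u x\<bar> powr p \<le> (norm x ^ mdeg \<beta> * ?G x) powr p"
      using p(1) m abs_mpow_le by (intro powr_mono2) (auto simp: abs_mult intro!: mult_mono)
    also have "\<dots> = ?h x"
      using False G0 by (simp add: powr_mult powr_powr mult.commute flip: powr_realpow)
    finally show ?thesis .
  qed
  have "bdd_supp (\<lambda>x. \<bar>?G x\<bar> powr p)"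
    using p(1) by (intro bdd_supp_abs_powr bdd_supp_integral w) simp
  \<comment> \<open>The exponent p |\<beta>| is positive, so the weight is continuous at the origin
    too.\<close>
  then have "bdd_supp (\<lambda>x. norm x powr (p * real (mdeg \<beta>)) * \<bar>?G x\<bar> powr p)"
    using p(1) \<beta> by (intro bdd_supp_mult_continuous continuous_on_powr') (auto intro!: continuous_intros)
  then have "integrable lborel ?h" using G0 by (simp add: bdd_supp_integrable)
  from Lp_norm_mono[OF _ this le p(1)] have uh: "Lp_norm p ?u \<le> mixed_norm p (mdeg \<beta>) (mdeg \<gamma>) f"
    using 1 by (simp add: mixed_norm_def)
  have b: "real ?j + 1 = real (mdeg \<beta>)" using \<beta> by simp
  have c: "0 \<le> Beta (real (mdeg \<beta>)) ?e"
    using e \<beta> by (auto simp: Beta_def intro!: divide_nonneg_nonneg mult_nonneg_nonneg less_imp_le[OF Gamma_real_pos])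
  have A2: "Lp_norm p (dilation_scaleR.average ?j ?u) \<le> Beta (real (mdeg \<beta>)) ?e * Lp_norm p ?u"
    using A(2)[unfolded b] e by simp
  have "Lp_norm p (R_op f \<beta> \<gamma>) = real (mdeg \<beta>) / mfact \<beta> * Lp_norm p (dilation_scaleR.average ?j ?u)"
    unfolding R_op_eq_average Lp_norm_cmult[OF p(1)] using mfact_pos[of \<beta>] by (simp add: abs_mult)
  also have "\<dots> \<le> real (mdeg \<beta>) / mfact \<beta> * (Beta (real (mdeg \<beta>)) ?e * mixed_norm p (mdeg \<beta>) (mdeg \<gamma>) f)"
    using order_trans[OF A2 mult_left_mono[OF uh c]] mfact_pos[of \<beta>] by (intro mult_left_mono) auto
  finally show "Lp_norm p (R_op f \<beta> \<gamma>)
      \<le> remainder_const p (mdeg \<beta>) \<beta> * mixed_norm p (mdeg \<beta>) (mdeg \<gamma>) f"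
    by (simp add: remainder_const_def)
qed

theorem lemma2p3:
  fixes f :: "(real ^ 'm::finite) \<times> (real ^ 'n::finite) \<Rightarrow> real" and k :: nat
  assumes "f \<in> test_functions"
  shows
    "(\<forall>\<phi>\<in>test_functions.
        distr_of f \<phi> =
          (\<Sum>(\<beta>, \<gamma>) | mdeg \<beta> + mdeg \<gamma> \<le> k.
             (-1) ^ (mdeg \<beta> + mdeg \<gamma>) / (mfact \<beta> * mfact \<gamma>) *
             (\<integral>(x, y). f (x, y) * mpow x \<beta> * mpow y \<gamma> \<partial>lborel) *
             distr_deriv frame_x \<beta> (distr_deriv frame_y \<gamma> dirac0) \<phi>)
        + (\<Sum>\<gamma> | mdeg \<gamma> \<le> k. \<Sum>\<beta> | mdeg \<beta> = k + 1 - mdeg \<gamma>.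
             (-1) ^ mdeg \<gamma> / mfact \<gamma> *
             distr_tensor (distr_deriv frame \<beta> (distr_of (R_op f \<beta> \<gamma>)))
                          (distr_deriv frame \<gamma> dirac0) \<phi>)
        + (\<Sum>\<gamma> | mdeg \<gamma> = k + 1. distr_deriv frame_y \<gamma> (distr_of (F_rem f k \<gamma>)) \<phi>))
     \<and> (\<forall>p (\<gamma> :: 'n \<Rightarrow> nat).
          1 \<le> p \<and> ereal p < ereal (real CARD('n)) / ereal (real CARD('n) - 1) \<and>
          mdeg \<gamma> = k + 1 \<longrightarrow>
          F_rem f k \<gamma> \<in> Lp_space p \<and>
          Lp_norm p (F_rem f k \<gamma>)
            \<le> remainder_const p (k + 1) \<gamma> * Lp_norm p (\<lambda>(x, y). norm y ^ (k + 1) * f (x, y)))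
     \<and> (\<forall>p (\<beta> :: 'm \<Rightarrow> nat) (\<gamma> :: 'n \<Rightarrow> nat).
          1 \<le> p \<and> ereal p < ereal (real CARD('m)) / ereal (real CARD('m) - 1) \<and>
          mdeg \<gamma> \<le> k \<and> mdeg \<beta> + mdeg \<gamma> = k + 1 \<longrightarrow>
          R_op f \<beta> \<gamma> \<in> Lp_space p \<and>
          Lp_norm p (R_op f \<beta> \<gamma>)
            \<le> remainder_const p (mdeg \<beta>) \<beta> * mixed_norm p (mdeg \<beta>) (mdeg \<gamma>) f)"
proof (intro conjI ballI allI impI distribution_identity[OF assms])
  fix p and \<beta> :: "'m \<Rightarrow> nat" and \<gamma> :: "'n \<Rightarrow> nat"
  assume *: "1 \<le> p \<and> ereal p < ereal (real CARD('m)) / ereal (real CARD('m) - 1) \<and>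
    mdeg \<gamma> \<le> k \<and> mdeg \<beta> + mdeg \<gamma> = k + 1"
  \<comment> \<open>From |\<gamma>| <= k follows |\<beta>| >= 1, so the truncated exponent |\<beta>|
    - 1 in \<open>R_op\<close> is the true one.\<close>
  then have "mdeg \<beta> \<noteq> 0" by linarith
  with * show "R_op f \<beta> \<gamma> \<in> Lp_space p"
    "Lp_norm p (R_op f \<beta> \<gamma>) \<le> remainder_const p (mdeg \<beta>) \<beta> * mixed_norm p (mdeg \<beta>) (mdeg \<gamma>) f"
    using R_op_bound[OF assms] by blast+
qed (use F_rem_bound[OF assms] in blast)+

end
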